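(* Let $(\Lambda,d)$ be a finitely aligned $k$-graph, and let $\mathcal{E}$ be any subset of $\mathrm{FE}(\Lambda)$. Then $C^*(\Lambda;\mathcal{E})=C^*(\Lambda;\overline{\mathcal{E}})$.
   Context: $k$-graphs. $\mathbb{N}$ contains $0$; $\mathbb{N}^k$ is ordered coordinatewise, $m\vee n$ is the coordinatewise maximum, and $0<n$ means $n \ge 0$, $n\neq 0$. For $k\in\mathbb{N}\setminus\{0\}$, a $k$-graph is a pair $(\Lambda,d)$ where $\Lambda$ is a countable category and $d:\Lambda\to\mathbb{N}^k$ is a functor satisfying the factorisation property: for every morphism $\lambda$ and all $m,n\in\mathbb{N}^k$ with $d(\lambda)=m+n$ there are unique morphisms $\mu,\nu$ with $d(\mu)=m$, $d(\nu)=n$, $\lambda=\mu\nu$. Write $\lambda\in\Lambda$ for morphisms ("paths"), $r,s$ for codomain and domain (so $\lambda\mu$ is defined when $s(\lambda)=r(\mu)$); objects ("vertices") are identified with the elements of $\Lambda^0=\{\lambda: d(\lambda)=0\}$. For $v\in\Lambda^0$, $v\Lambda=\{\lambda: r(\lambda)=v\}$. For $E\subset\Lambda$, $\lambda E=\{\lambda\mu:\mu\in E, r(\mu)=s(\lambda)\}$ and $E\Lambda=\{\lambda\mu:\lambda\in E,\ \mu \in s(\lambda)\Lambda\}$. For $l\le m\le d(\lambda)$, $\lambda(l,m)$ is the unique path of degree $m-l$ with $\lambda=\lambda(0,l)\lambda(l,m)\lambda(m,d(\lambda))$. Finite exhaustive sets. For $\mu,\nu\in\Lambda$, $\mathrm{MCE}(\mu,\nu)$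 is the set of $\lambda$ with $d(\lambda)=d(\mu)\vee d(\nu)$, $\lambda(0,d(\mu))=\mu$, $\lambda(0,d(\nu))=\nu$; $\Lambda^{\min}(\mu,\nu)=\{(\alpha,\beta)\in \Lambda\times\Lambda:\mu\alpha=\nu\beta\in\mathrm{MCE}(\mu,\nu)\}$. $\Lambda$ is finitely aligned if every $\mathrm{MCE}(\mu,\nu)$ is finite (possibly empty). For $E\subset\Lambda$, $\mathrm{Ext}(\mu;E)=\{\alpha\in s(\mu)\Lambda:(\alpha,\beta)\in\Lambda^{\min}(\mu,\nu)\text{ for some }\nu\in E \text{ and some } \beta\}$. A set $E\subset v\Lambda$ is exhaustive if $\mathrm{Ext}(\lambda;E)\neq\emptyset$ for all $\lambda\in v\Lambda$. $\mathrm{FE}(\Lambda)=\bigcup_{v\in\Lambda^0}\{E\subset v\Lambda\setminus\{v\}: E\text{ finite and exhaustive}\}$; for $E\in\mathrm{FE}(\Lambda)$, $r(E)$ is the vertex $v$ with $E\subset v\Lambda$. Relative Cuntz-Krieger algebras. For $\mathcal{E}\subset\mathrm{FE}(\Lambda)$, a relative Cuntz-Krieger $(\Lambda;\mathcal{E})$-family is a collection $\{t_\lambda:\lambda\in\Lambda\}$ of partial isometries in a $C^*$-algebra such that: (TCK1) $\{t_v:v\in\Lambda^0\}$ are mutually orthogonal projections; (TCK2) $t_\lambda t_\mu=t_{\lambda\mu}$ whenever $s(\lambda)=r(\mu)$; (TCK3) $t_\lambda^*t_\mu=\sum_{(\alpha,\beta)\in\Lambda^{\min}(\lambda,\mu)}t_\alpha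 t_\beta^*$ for all $\lambda,\mu$ (empty sum $=0$); (CK) $\prod_{\lambda\in E}(t_{r(E)}-t_\lambda t_\lambda^* )=0$ for all $E\in\mathcal{E}$. (By (TCK3) the projections $t_\lambda t_\lambda^*$ commute, so products are well defined.) $C^*(\Lambda;\mathcal{E})$ is the universal $C^*$-algebra generated by a relative Cuntz-Krieger $(\Lambda;\mathcal{E})$-family $\{s_{\mathcal{E}}(\lambda)\}$: for every relative Cuntz-Krieger $(\Lambda;\mathcal{E})$-family $\{t_\lambda\}$ in a $C^*$-algebra $B$ there is a unique homomorphism $C^*(\Lambda;\mathcal{E})\to B$ with $s_{\mathcal{E}}(\lambda)\mapsto t_\lambda$. Equality of two such universal algebras means that they coincide as universal objects, i.e. that there is an isomorphism $C^*(\Lambda;\mathcal{E})\to C^*(\Lambda;\overline{\mathcal{E}})$ carrying $s_{\mathcal{E}}(\lambda)$ to $s_{\overline{\mathcal{E}}}(\lambda)$ for every $\lambda\in\Lambda$. Satiated; satiation. $\mathcal{E}\subset\mathrm{FE}(\Lambda)$ is satiated if: (S1) $G\in\mathcal{E}$, $E\in\mathrm{FE}(\Lambda)$, $G\subset E$ imply $E\in\mathcal{E}$; (S2) if $G\in\mathcal{E}$ with $r(G)=v$ and $\mu\in v\Lambda\setminus G\Lambda$, then $\mathrm{Ext}(\mu;G)\in\mathcal{E}$; (S3) if $G\in\mathcal{E}$ and $0<n_\lambda\le d(\lambda)$ for each $\lambda\in G$, then $\{\lambda(0,n_\lambda):\lambda\in G\}\in\mathcal{E}$; (S4) if $G\in\mathcal{E}$,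 $G'\subset G$ and $G'_\lambda\in\mathcal{E}$ with $r(G'_\lambda)=s(\lambda)$ for each $\lambda\in G'$, then $(G\setminus G')\cup\bigcup_{\lambda\in G'}\lambda G'_\lambda\in\mathcal{E}$. The satiation $\overline{\mathcal{E}}$ of $\mathcal{E}$ is the smallest satiated subset of $\mathrm{FE}(\Lambda)$ containing $\mathcal{E}$. *)

theory Defs
  imports
    "HOL-Analysis.Analysis"
    "HOL-Algebra.Module"
    "HOL-Decision_Procs.Algebra_Aux"
begin

section \<open>Higher-rank graphs\<close>

text \<open>
  A small category is presented by its morphisms alone, its objects being identified with its
  identity morphisms; thus \<open>rng\<close> (codomain) and \<open>src\<close> (domain) return morphisms.
  The product \<open>comp L \<mu> \<nu>\<close> is meaningful only when \<open>src L \<mu> = rng L \<nu>\<close>.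
  Degrees lie in \<open>nat ^ 'k\<close>, whose order is coordinatewise and in which \<open>0 < n\<close> means
  \<open>0 \<le> n\<close> and \<open>n \<noteq> 0\<close>; the rank is \<open>CARD('k) \<ge> 1\<close>.
\<close>

record ('l, 'k) kgraph =
  paths :: "'l set"
  rng :: "'l \<Rightarrow> 'l"
  src :: "'l \<Rightarrow> 'l"
  comp :: "'l \<Rightarrow> 'l \<Rightarrow> 'l"
  deg :: "'l \<Rightarrow> nat ^ 'k"

locale small_category =
  fixes L :: "('l, 'k::finite) kgraph"
  assumes rng_closed: "\<kappa> \<in> paths L \<Longrightarrow> rng L \<kappa> \<in> paths L"
    and src_closed: "\<kappa> \<in> paths L \<Longrightarrow> src L \<kappa> \<in> paths L"
    and rng_rng: "\<kappa> \<in> paths L \<Longrightarrow> rng L (rng L \<kappa>) = rng L \<kappa>"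
    and src_rng: "\<kappa> \<in> paths L \<Longrightarrow> src L (rng L \<kappa>) = rng L \<kappa>"
    and rng_src: "\<kappa> \<in> paths L \<Longrightarrow> rng L (src L \<kappa>) = src L \<kappa>"
    and src_src: "\<kappa> \<in> paths L \<Longrightarrow> src L (src L \<kappa>) = src L \<kappa>"
    and comp_closed:
      "\<lbrakk>\<mu> \<in> paths L; \<nu> \<in> paths L; src L \<mu> = rng L \<nu>\<rbrakk> \<Longrightarrow> comp L \<mu> \<nu> \<in> paths L"
    and rng_comp:
      "\<lbrakk>\<mu> \<in> paths L; \<nu> \<in> paths L; src L \<mu> = rng L \<nu>\<rbrakk> \<Longrightarrow> rng L (comp L \<mu> \<nu>) = rng L \<mu>"
    and src_comp:
      "\<lbrakk>\<mu> \<in> paths L; \<nu> \<in> paths L; src L \<mu> = rng L \<nu>\<rbrakk> \<Longrightarrow> src L (comp L \<mu> \<nu>) = src L \<nu>"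
    and comp_id_left: "\<kappa> \<in> paths L \<Longrightarrow> comp L (rng L \<kappa>) \<kappa> = \<kappa>"
    and comp_id_right: "\<kappa> \<in> paths L \<Longrightarrow> comp L \<kappa> (src L \<kappa>) = \<kappa>"
    and comp_assoc:
      "\<lbrakk>\<kappa> \<in> paths L; \<mu> \<in> paths L; \<nu> \<in> paths L; src L \<kappa> = rng L \<mu>; src L \<mu> = rng L \<nu>\<rbrakk>
        \<Longrightarrow> comp L (comp L \<kappa> \<mu>) \<nu> = comp L \<kappa> (comp L \<mu> \<nu>)"

locale k_graph = small_category L for L :: "('l, 'k::finite) kgraph" +
  assumes countable_paths: "countable (paths L)"
    and deg_id: "\<kappa> \<in> paths L \<Longrightarrow> deg L (rng L \<kappa>) = 0 \<and> deg L (src L \<kappa>) = 0"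
    and deg_comp:
      "\<lbrakk>\<mu> \<in> paths L; \<nu> \<in> paths L; src L \<mu> = rng L \<nu>\<rbrakk>
        \<Longrightarrow> deg L (comp L \<mu> \<nu>) = deg L \<mu> + deg L \<nu>"
    and factorisation:
      "\<lbrakk>\<kappa> \<in> paths L; deg L \<kappa> = m + n\<rbrakk>
        \<Longrightarrow> \<exists>!p. fst p \<in> paths L \<and> snd p \<in> paths L \<and> src L (fst p) = rng L (snd p) \<and>
              deg L (fst p) = m \<and> deg L (snd p) = n \<and> \<kappa> = comp L (fst p) (snd p)"

definition vertices :: "('l, 'k::finite) kgraph \<Rightarrow> 'l set" where
  "vertices L = {\<kappa> \<in> paths L. deg L \<kappa> = 0}"

definition paths_to :: "('l, 'k::finite) kgraph \<Rightarrow> 'l \<Rightarrow> 'l set" where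
  "paths_to L v = {\<kappa> \<in> paths L. rng L \<kappa> = v}"

definition left_translate :: "('l, 'k::finite) kgraph \<Rightarrow> 'l \<Rightarrow> 'l set \<Rightarrow> 'l set" where
  "left_translate L \<kappa> E = {comp L \<kappa> \<mu> |\<mu>. \<mu> \<in> E \<and> rng L \<mu> = src L \<kappa>}"

definition extensions :: "('l, 'k::finite) kgraph \<Rightarrow> 'l set \<Rightarrow> 'l set" where
  "extensions L E = {comp L \<kappa> \<mu> |\<kappa> \<mu>. \<kappa> \<in> E \<and> \<mu> \<in> paths_to L (src L \<kappa>)}"

text \<open>The segment \<open>\<kappa>(l,m)\<close>, for \<open>l \<le> m \<le> deg L \<kappa>\<close>.\<close>

definition segment :: "('l, 'k::finite) kgraph \<Rightarrow> 'l \<Rightarrow> nat ^ 'k \<Rightarrow> nat ^ 'k \<Rightarrow> 'l" where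
  "segment L \<kappa> l m = (THE \<mu>. \<mu> \<in> paths L \<and> deg L \<mu> = m - l \<and>
     (\<exists>\<alpha>\<in>paths L. \<exists>\<beta>\<in>paths L. deg L \<alpha> = l \<and> deg L \<beta> = deg L \<kappa> - m \<and>
        src L \<alpha> = rng L \<mu> \<and> src L \<mu> = rng L \<beta> \<and> \<kappa> = comp L \<alpha> (comp L \<mu> \<beta>)))"

definition vec_max :: "nat ^ 'k \<Rightarrow> nat ^ 'k \<Rightarrow> nat ^ 'k::finite" where
  "vec_max m n = (\<chi> i. max (m $ i) (n $ i))"

definition MCE :: "('l, 'k::finite) kgraph \<Rightarrow> 'l \<Rightarrow> 'l \<Rightarrow> 'l set" where
  "MCE L \<mu> \<nu> = {\<kappa> \<in> paths L. deg L \<kappa> = vec_max (deg L \<mu>) (deg L \<nu>) \<and>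
     segment L \<kappa> 0 (deg L \<mu>) = \<mu> \<and> segment L \<kappa> 0 (deg L \<nu>) = \<nu>}"

definition Lambda_min :: "('l, 'k::finite) kgraph \<Rightarrow> 'l \<Rightarrow> 'l \<Rightarrow> ('l \<times> 'l) set" where
  "Lambda_min L \<mu> \<nu> = {(\<alpha>, \<beta>). \<alpha> \<in> paths_to L (src L \<mu>) \<and> \<beta> \<in> paths_to L (src L \<nu>) \<and>
     comp L \<mu> \<alpha> = comp L \<nu> \<beta> \<and> comp L \<mu> \<alpha> \<in> MCE L \<mu> \<nu>}"

definition finitely_aligned :: "('l, 'k::finite) kgraph \<Rightarrow> bool" where
  "finitely_aligned L \<longleftrightarrow> (\<forall>\<mu>\<in>paths L. \<forall>\<nu>\<in>paths L. finite (MCE L \<mu> \<nu>))"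

definition Ext :: "('l, 'k::finite) kgraph \<Rightarrow> 'l \<Rightarrow> 'l set \<Rightarrow> 'l set" where
  "Ext L \<mu> E = {\<alpha> \<in> paths_to L (src L \<mu>). \<exists>\<nu>\<in>E. \<exists>\<beta>. (\<alpha>, \<beta>) \<in> Lambda_min L \<mu> \<nu>}"

definition exhaustive :: "('l, 'k::finite) kgraph \<Rightarrow> 'l \<Rightarrow> 'l set \<Rightarrow> bool" where
  "exhaustive L v E \<longleftrightarrow> E \<subseteq> paths_to L v \<and> (\<forall>\<kappa>\<in>paths_to L v. Ext L \<kappa> E \<noteq> {})"

definition FE :: "('l, 'k::finite) kgraph \<Rightarrow> 'l set set" where
  "FE L = (\<Union>v\<in>vertices L. {E. E \<subseteq> paths_to L v - {v} \<and> finite E \<and> exhaustive L v E})"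

text \<open>Well defined on \<open>FE L\<close>, whose members are nonempty.\<close>

definition range_vertex :: "('l, 'k::finite) kgraph \<Rightarrow> 'l set \<Rightarrow> 'l" where
  "range_vertex L E = (THE v. v \<in> vertices L \<and> E \<subseteq> paths_to L v)"

definition satiated :: "('l, 'k::finite) kgraph \<Rightarrow> 'l set set \<Rightarrow> bool" where
  "satiated L \<E> \<longleftrightarrow> \<E> \<subseteq> FE L \<and>
     (\<forall>G\<in>\<E>. \<forall>E\<in>FE L. G \<subseteq> E \<longrightarrow> E \<in> \<E>) \<and>
     (\<forall>G\<in>\<E>. \<forall>\<mu>\<in>paths_to L (range_vertex L G) - extensions L G. Ext L \<mu> G \<in> \<E>) \<and>
     (\<forall>G\<in>\<E>. \<forall>n. (\<forall>\<kappa>\<in>G. 0 < n \<kappa> \<and> n \<kappa> \<le> deg L \<kappa>) \<longrightarrow>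
        (\<lambda>\<kappa>. segment L \<kappa> 0 (n \<kappa>)) ` G \<in> \<E>) \<and>
     (\<forall>G\<in>\<E>. \<forall>G'\<subseteq>G. \<forall>H. (\<forall>\<kappa>\<in>G'. H \<kappa> \<in> \<E> \<and> range_vertex L (H \<kappa>) = src L \<kappa>) \<longrightarrow>
        (G - G') \<union> (\<Union>\<kappa>\<in>G'. left_translate L \<kappa> (H \<kappa>)) \<in> \<E>)"

definition satiation :: "('l, 'k::finite) kgraph \<Rightarrow> 'l set set \<Rightarrow> 'l set set" where
  "satiation L \<E> = \<Inter> {S. satiated L S \<and> \<E> \<subseteq> S}"

section \<open>C*-algebras\<close>

text \<open>
  C*-algebras are not assumed unital: the component \<open>one\<close> inherited from the ring record is
  ignored throughout.
\<close>

record 'a cstar = "(complex, 'a) module" +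
  star :: "'a \<Rightarrow> 'a"
  cnorm :: "'a \<Rightarrow> real"

text \<open>The case distinction only serves the library's \<open>Metric_space\<close>, which wants
  nonnegativity and symmetry outside the carrier as well.\<close>

definition cdist :: "'a cstar \<Rightarrow> 'a \<Rightarrow> 'a \<Rightarrow> real" where
  "cdist A x y = (if x \<in> carrier A \<and> y \<in> carrier A then cnorm A (x \<ominus>\<^bsub>A\<^esub> y) else 0)"

locale cstar_algebra = Module.module cring_class_ops A for A :: "'a cstar" (structure) +
  assumes mult_closed: "\<lbrakk>x \<in> carrier A; y \<in> carrier A\<rbrakk> \<Longrightarrow> x \<otimes> y \<in> carrier A"
    and mult_assoc:
      "\<lbrakk>x \<in> carrier A; y \<in> carrier A; z \<in> carrier A\<rbrakk> \<Longrightarrow> (x \<otimes> y) \<otimes> z = x \<otimes> (y \<otimes> z)"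
    and distrib_right:
      "\<lbrakk>x \<in> carrier A; y \<in> carrier A; z \<in> carrier A\<rbrakk> \<Longrightarrow> (x \<oplus> y) \<otimes> z = x \<otimes> z \<oplus> y \<otimes> z"
    and distrib_left:
      "\<lbrakk>x \<in> carrier A; y \<in> carrier A; z \<in> carrier A\<rbrakk> \<Longrightarrow> z \<otimes> (x \<oplus> y) = z \<otimes> x \<oplus> z \<otimes> y"
    and smult_mult_left:
      "\<lbrakk>x \<in> carrier A; y \<in> carrier A\<rbrakk> \<Longrightarrow> (c \<odot> x) \<otimes> y = c \<odot> (x \<otimes> y)"
    and smult_mult_right:
      "\<lbrakk>x \<in> carrier A; y \<in> carrier A\<rbrakk> \<Longrightarrow> x \<otimes> (c \<odot> y) = c \<odot> (x \<otimes> y)"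
    and star_closed: "x \<in> carrier A \<Longrightarrow> star A x \<in> carrier A"
    and star_star: "x \<in> carrier A \<Longrightarrow> star A (star A x) = x"
    and star_add: "\<lbrakk>x \<in> carrier A; y \<in> carrier A\<rbrakk> \<Longrightarrow> star A (x \<oplus> y) = star A x \<oplus> star A y"
    and star_smult: "x \<in> carrier A \<Longrightarrow> star A (c \<odot> x) = cnj c \<odot> star A x"
    and star_mult: "\<lbrakk>x \<in> carrier A; y \<in> carrier A\<rbrakk> \<Longrightarrow> star A (x \<otimes> y) = star A y \<otimes> star A x"
    and norm_nonneg: "x \<in> carrier A \<Longrightarrow> 0 \<le> cnorm A x"
    and norm_eq_zero: "x \<in> carrier A \<Longrightarrow> cnorm A x = 0 \<longleftrightarrow> x = \<zero>"
    and norm_triangle: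
      "\<lbrakk>x \<in> carrier A; y \<in> carrier A\<rbrakk> \<Longrightarrow> cnorm A (x \<oplus> y) \<le> cnorm A x + cnorm A y"
    and norm_smult: "x \<in> carrier A \<Longrightarrow> cnorm A (c \<odot> x) = cmod c * cnorm A x"
    and norm_mult:
      "\<lbrakk>x \<in> carrier A; y \<in> carrier A\<rbrakk> \<Longrightarrow> cnorm A (x \<otimes> y) \<le> cnorm A x * cnorm A y"
    and cstar_identity: "x \<in> carrier A \<Longrightarrow> cnorm A (star A x \<otimes> x) = (cnorm A x)\<^sup>2"
    and complete: "Metric_space.mcomplete (carrier A) (cdist A)"

definition star_hom :: "'a cstar \<Rightarrow> 'b cstar \<Rightarrow> ('a \<Rightarrow> 'b) \<Rightarrow> bool" where
  "star_hom A B \<phi> \<longleftrightarrow>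
     \<phi> \<in> carrier A \<rightarrow> carrier B \<and>
     (\<forall>x\<in>carrier A. \<forall>y\<in>carrier A. \<phi> (x \<oplus>\<^bsub>A\<^esub> y) = \<phi> x \<oplus>\<^bsub>B\<^esub> \<phi> y) \<and>
     (\<forall>x\<in>carrier A. \<forall>y\<in>carrier A. \<phi> (x \<otimes>\<^bsub>A\<^esub> y) = \<phi> x \<otimes>\<^bsub>B\<^esub> \<phi> y) \<and>
     (\<forall>c. \<forall>x\<in>carrier A. \<phi> (c \<odot>\<^bsub>A\<^esub> x) = c \<odot>\<^bsub>B\<^esub> \<phi> x) \<and>
     (\<forall>x\<in>carrier A. \<phi> (star A x) = star B (\<phi> x))"

definition star_iso :: "'a cstar \<Rightarrow> 'b cstar \<Rightarrow> ('a \<Rightarrow> 'b) \<Rightarrow> bool" where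
  "star_iso A B \<phi> \<longleftrightarrow> star_hom A B \<phi> \<and> bij_betw \<phi> (carrier A) (carrier B)"

definition closed_star_subalgebra :: "'a cstar \<Rightarrow> 'a set \<Rightarrow> bool" where
  "closed_star_subalgebra A D \<longleftrightarrow>
     \<zero>\<^bsub>A\<^esub> \<in> D \<and>
     (\<forall>x\<in>D. \<forall>y\<in>D. x \<oplus>\<^bsub>A\<^esub> y \<in> D \<and> x \<otimes>\<^bsub>A\<^esub> y \<in> D) \<and>
     (\<forall>c. \<forall>x\<in>D. c \<odot>\<^bsub>A\<^esub> x \<in> D) \<and>
     (\<forall>x\<in>D. star A x \<in> D) \<and>
     closedin (Metric_space.mtopology (carrier A) (cdist A)) D"

definition generates :: "'a cstar \<Rightarrow> 'a set \<Rightarrow> bool" where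
  "generates A X \<longleftrightarrow> X \<subseteq> carrier A \<and>
     (\<forall>D. closed_star_subalgebra A D \<and> X \<subseteq> D \<longrightarrow> D = carrier A)"

definition projection :: "'a cstar \<Rightarrow> 'a \<Rightarrow> bool" where
  "projection A p \<longleftrightarrow> p \<in> carrier A \<and> star A p = p \<and> p \<otimes>\<^bsub>A\<^esub> p = p"

definition partial_isometry :: "'a cstar \<Rightarrow> 'a \<Rightarrow> bool" where
  "partial_isometry A x \<longleftrightarrow> x \<in> carrier A \<and> x \<otimes>\<^bsub>A\<^esub> star A x \<otimes>\<^bsub>A\<^esub> x = x"

text \<open>Product of a nonempty list. The empty product has no meaning without a unit.\<close>

fun list_prod :: "'a cstar \<Rightarrow> 'a list \<Rightarrow> 'a" where
  "list_prod A [x] = x"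
| "list_prod A (x # y # xs) = x \<otimes>\<^bsub>A\<^esub> list_prod A (y # xs)"

section \<open>Relative Cuntz--Krieger algebras\<close>

text \<open>
  In the last clause the product over the finite set \<open>E\<close> (nonempty, since \<open>E\<close> is exhaustive) is
  taken along an arbitrary enumeration of \<open>E\<close>; its factors commute by the clause before.
\<close>

definition relative_CK_family ::
  "('l, 'k::finite) kgraph \<Rightarrow> 'l set set \<Rightarrow> 'a cstar \<Rightarrow> ('l \<Rightarrow> 'a) \<Rightarrow> bool" where
  "relative_CK_family L \<E> B t \<longleftrightarrow>
     (\<forall>\<kappa>\<in>paths L. partial_isometry B (t \<kappa>)) \<and>
     (\<forall>v\<in>vertices L. projection B (t v)) \<and>
     (\<forall>v\<in>vertices L. \<forall>w\<in>vertices L. v \<noteq> w \<longrightarrow> t v \<otimes>\<^bsub>B\<^esub> t w = \<zero>\<^bsub>B\<^esub>) \<and>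
     (\<forall>\<kappa>\<in>paths L. \<forall>\<mu>\<in>paths L. src L \<kappa> = rng L \<mu> \<longrightarrow> t \<kappa> \<otimes>\<^bsub>B\<^esub> t \<mu> = t (comp L \<kappa> \<mu>)) \<and>
     (\<forall>\<kappa>\<in>paths L. \<forall>\<mu>\<in>paths L. star B (t \<kappa>) \<otimes>\<^bsub>B\<^esub> t \<mu> =
        (\<Oplus>\<^bsub>B\<^esub>p\<in>Lambda_min L \<kappa> \<mu>. t (fst p) \<otimes>\<^bsub>B\<^esub> star B (t (snd p)))) \<and>
     (\<forall>E\<in>\<E>. \<forall>es. distinct es \<and> set es = E \<longrightarrow>
        list_prod B (map (\<lambda>\<kappa>. t (range_vertex L E) \<ominus>\<^bsub>B\<^esub> (t \<kappa> \<otimes>\<^bsub>B\<^esub> star B (t \<kappa>))) es) = \<zero>\<^bsub>B\<^esub>)"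

text \<open>
  The pair \<open>(A, s)\<close> is (a model of) the C*-algebra of \<open>L\<close> relative to \<open>\<E>\<close> with its canonical
  generators. The test algebras \<open>B\<close> range over all C*-algebras carried by subsets of \<open>'u\<close>.
  A C*-algebra generated by the countable family \<open>t\<close> has at most continuum many elements, so as
  soon as \<open>'u\<close> has at least the cardinality of the continuum, every such family lives up to
  isomorphism in an algebra on \<open>'u\<close>, and this is the universal property with respect to
  arbitrary C*-algebras.
\<close>

definition is_relative_CK_algebra ::
  "('l, 'k::finite) kgraph \<Rightarrow> 'l set set \<Rightarrow> 'u cstar \<Rightarrow> ('l \<Rightarrow> 'u) \<Rightarrow> bool" where
  "is_relative_CK_algebra L \<E> A s \<longleftrightarrow>
     cstar_algebra A \<and> relative_CK_family L \<E> A s \<and> generates A (s ` paths L) \<and>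
     (\<forall>(B :: 'u cstar) t. cstar_algebra B \<and> relative_CK_family L \<E> B t \<longrightarrow>
        (\<exists>\<phi>. star_hom A B \<phi> \<and> (\<forall>\<kappa>\<in>paths L. \<phi> (s \<kappa>) = t \<kappa>) \<and>
           (\<forall>\<psi>. star_hom A B \<psi> \<and> (\<forall>\<kappa>\<in>paths L. \<psi> (s \<kappa>) = t \<kappa>) \<longrightarrow>
              (\<forall>x\<in>carrier A. \<psi> x = \<phi> x))))"

end

theory Submission
  imports Defs
begin

text \<open>
  Universal algebras for two relations agree as soon as the same families satisfy both relations
  (\<open>universal_algebras_same_families_iso\<close>), so it suffices that a relative Cuntz--Krieger family
  for \<open>\<E>\<close> is automatically one for the satiation of \<open>\<E>\<close>. The satiation is the smallest satiated set
  above \<open>\<E>\<close>; hence this follows once, for a fixed family \<open>t\<close> satisfying the first three relations,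
  the set of those \<open>E \<in> FE(\<Lambda>)\<close> at which \<open>t\<close> satisfies the Cuntz--Krieger relation is shown to be
  satiated.

  The relation \<open>\<Prod>\<^sub>\<lambda> (t\<^sub>v - t\<^sub>\<lambda>t\<^sub>\<lambda>\<^sup>*) = 0\<close> over \<open>\<lambda> \<in> E\<close> is awkward to transport from one set to another.
  Because the range projections commute, it is equivalent to a cancellation property (\<open>covers\<close>): an
  element \<open>x\<close> with \<open>t\<^sub>vx = x\<close> and \<open>t\<^sub>\<lambda>\<^sup>*x = 0\<close> for all \<open>\<lambda> \<in> E\<close> must vanish. In this form the closure
  conditions are short computations with the element \<open>x\<close>. Enlarging \<open>E\<close> only strengthens the
  hypothesis on \<open>x\<close>. For \<open>Ext(\<mu>;G)\<close> the property for \<open>G\<close> is applied to \<open>t\<^sub>\<mu>x\<close>. If \<open>\<lambda> = \<mu>\<nu>\<close>, then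
  \<open>t\<^sub>\<lambda>\<^sup>*x = t\<^sub>\<nu>\<^sup>*(t\<^sub>\<mu>\<^sup>*x)\<close>, which settles the passage to initial segments; and when \<open>\<lambda>\<close> is replaced by the
  paths \<open>\<lambda>\<mu>\<close> with \<open>\<mu> \<in> H\<close>, the property for \<open>H\<close> applied to \<open>t\<^sub>\<lambda>\<^sup>*x\<close> gives \<open>t\<^sub>\<lambda>\<^sup>*x = 0\<close>.

  What remains is that these operations lead from \<open>FE(\<Lambda>)\<close> to itself. This is combinatorics of
  common extensions, in which finite alignment enters only through the finiteness of \<open>Ext(\<mu>;G)\<close>.
\<close>

section \<open>Factorisations and minimal common extensions\<close>

lemma le_add_diff_vec:
  fixes m n :: "nat ^ 'k::finite"
  assumes "m \<le> n"
  shows "m + (n - m) = n"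
  using assms by (auto simp: vec_eq_iff less_eq_vec_def)

context k_graph
begin

lemma factorisation_unique:
  assumes "\<mu> \<in> paths L" "\<nu> \<in> paths L" "src L \<mu> = rng L \<nu>"
    and "\<mu>' \<in> paths L" "\<nu>' \<in> paths L" "src L \<mu>' = rng L \<nu>'"
    and "deg L \<mu> = deg L \<mu>'" and "comp L \<mu> \<nu> = comp L \<mu>' \<nu>'"
  shows "\<mu> = \<mu>' \<and> \<nu> = \<nu>'"
proof -
  have cl: "comp L \<mu> \<nu> \<in> paths L" using assms comp_closed by blast
  note d = deg_comp[OF assms(1-3)]
  have dn: "deg L \<nu> = deg L \<nu>'" using d deg_comp[OF assms(4-6)] assms(7,8) by simp
  from factorisation[OF cl d] obtain p where p: "q = p"
    if "fst q \<in> paths L \<and> snd q \<in> paths L \<and> src L (fst q) = rng L (snd q) \<and>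
      deg L (fst q) = deg L \<mu> \<and> deg L (snd q) = deg L \<nu> \<and>
      comp L \<mu> \<nu> = comp L (fst q) (snd q)" for q
    unfolding Ex1_def by blast
  have "(\<mu>, \<nu>) = p" by (rule p) (use assms in simp)
  moreover have "(\<mu>', \<nu>') = p" by (rule p) (use assms dn in simp)
  ultimately have "(\<mu>, \<nu>) = (\<mu>', \<nu>')" by simp
  thus ?thesis by simp
qed

lemma comp_left_cancel:
  assumes "\<mu> \<in> paths L" "\<alpha> \<in> paths_to L (src L \<mu>)" "\<beta> \<in> paths_to L (src L \<mu>)"
    and "comp L \<mu> \<alpha> = comp L \<mu> \<beta>"
  shows "\<alpha> = \<beta>"
  by (rule conjunct2[OF factorisation_unique[OF assms(1) _ _ assms(1) _ _ refl assms(4)]])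
    (use assms in \<open>auto simp: paths_to_def\<close>)

lemma vertex_is_identity:
  assumes "\<kappa> \<in> paths L" "deg L \<kappa> = 0"
  shows "rng L \<kappa> = \<kappa>" "src L \<kappa> = \<kappa>"
proof -
  have "rng L \<kappa> = \<kappa> \<and> \<kappa> = src L \<kappa>"
    by (rule factorisation_unique)
      (use assms rng_closed src_closed src_rng rng_src deg_id comp_id_left comp_id_right in auto)
  thus "rng L \<kappa> = \<kappa>" "src L \<kappa> = \<kappa>" by auto
qed

lemma rng_in_vertices: "\<kappa> \<in> paths L \<Longrightarrow> rng L \<kappa> \<in> vertices L"
  and src_in_vertices: "\<kappa> \<in> paths L \<Longrightarrow> src L \<kappa> \<in> vertices L"
  by (auto simp: vertices_def rng_closed src_closed deg_id)

lemma initial_factor_exists: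
  assumes "\<kappa> \<in> paths L" "m \<le> deg L \<kappa>"
  obtains \<mu> \<nu> where "\<mu> \<in> paths L" "\<nu> \<in> paths L" "src L \<mu> = rng L \<nu>"
    "deg L \<mu> = m" "\<kappa> = comp L \<mu> \<nu>"
  using factorisation[OF assms(1) le_add_diff_vec[OF assms(2), symmetric]] that
  unfolding Ex1_def by blast

lemma segment_initial:
  assumes "\<mu> \<in> paths L" "\<nu> \<in> paths L" "src L \<mu> = rng L \<nu>"
  shows "segment L (comp L \<mu> \<nu>) 0 (deg L \<mu>) = \<mu>"
  unfolding segment_def
proof (rule the_equality)
  have "comp L \<mu> \<nu> = comp L (rng L \<mu>) (comp L \<mu> \<nu>)"
    using assms comp_closed comp_id_left[of "comp L \<mu> \<nu>"] rng_comp by simp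
  moreover have "rng L \<mu> \<in> paths L" "deg L (rng L \<mu>) = 0" "src L (rng L \<mu>) = rng L \<mu>"
    using assms rng_closed deg_id src_rng by auto
  moreover have "deg L \<nu> = deg L (comp L \<mu> \<nu>) - deg L \<mu>" "deg L \<mu> = deg L \<mu> - 0"
    using assms by (auto simp: deg_comp vec_eq_iff)
  ultimately show "\<mu> \<in> paths L \<and> deg L \<mu> = deg L \<mu> - 0 \<and>
    (\<exists>\<alpha>\<in>paths L. \<exists>\<beta>\<in>paths L. deg L \<alpha> = 0 \<and> deg L \<beta> = deg L (comp L \<mu> \<nu>) - deg L \<mu> \<and>
       src L \<alpha> = rng L \<mu> \<and> src L \<mu> = rng L \<beta> \<and> comp L \<mu> \<nu> = comp L \<alpha> (comp L \<mu> \<beta>))"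
    using assms by blast
next
  fix \<mu>'
  assume "\<mu>' \<in> paths L \<and> deg L \<mu>' = deg L \<mu> - 0 \<and>
    (\<exists>\<alpha>\<in>paths L. \<exists>\<beta>\<in>paths L. deg L \<alpha> = 0 \<and> deg L \<beta> = deg L (comp L \<mu> \<nu>) - deg L \<mu> \<and>
       src L \<alpha> = rng L \<mu>' \<and> src L \<mu>' = rng L \<beta> \<and> comp L \<mu> \<nu> = comp L \<alpha> (comp L \<mu>' \<beta>))"
  then obtain \<alpha> \<beta> where *: "\<mu>' \<in> paths L" "deg L \<mu>' = deg L \<mu>" "\<alpha> \<in> paths L" "\<beta> \<in> paths L"
    "deg L \<alpha> = 0" "src L \<alpha> = rng L \<mu>'" "src L \<mu>' = rng L \<beta>"
    "comp L \<mu> \<nu> = comp L \<alpha> (comp L \<mu>' \<beta>)"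
    by (auto simp: vec_eq_iff)
  have "\<alpha> = rng L \<mu>'" using vertex_is_identity(2)[of \<alpha>] * by simp
  hence "comp L \<mu> \<nu> = comp L \<mu>' \<beta>"
    using * comp_closed[of \<mu>' \<beta>] comp_id_left[of "comp L \<mu>' \<beta>"] rng_comp[of \<mu>' \<beta>] by simp
  thus "\<mu>' = \<mu>" using factorisation_unique[of \<mu>' \<beta> \<mu> \<nu>] assms * by simp
qed

lemma vec_max_upper: "m \<le> vec_max m n" "n \<le> vec_max m n"
  and vec_max_least: "m \<le> p \<Longrightarrow> n \<le> p \<Longrightarrow> vec_max m n \<le> p"
  by (auto simp: vec_max_def less_eq_vec_def)

lemma Lambda_min_iff:
  assumes "\<mu> \<in> paths L" "\<nu> \<in> paths L"
  shows "(\<alpha>, \<beta>) \<in> Lambda_min L \<mu> \<nu> \<longleftrightarrow>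
    \<alpha> \<in> paths_to L (src L \<mu>) \<and> \<beta> \<in> paths_to L (src L \<nu>) \<and> comp L \<mu> \<alpha> = comp L \<nu> \<beta> \<and>
    deg L (comp L \<mu> \<alpha>) = vec_max (deg L \<mu>) (deg L \<nu>)"
proof -
  have "comp L \<mu> \<alpha> \<in> MCE L \<mu> \<nu>"
    if "\<alpha> \<in> paths L" "rng L \<alpha> = src L \<mu>" "\<beta> \<in> paths L" "rng L \<beta> = src L \<nu>"
      "comp L \<mu> \<alpha> = comp L \<nu> \<beta>" "deg L (comp L \<mu> \<alpha>) = vec_max (deg L \<mu>) (deg L \<nu>)"
    using that assms segment_initial[of \<mu> \<alpha>] segment_initial[of \<nu> \<beta>] comp_closed
    by (simp add: MCE_def)
  thus ?thesis by (auto simp: Lambda_min_def paths_to_def MCE_def)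
qed

lemma Lambda_min_swap:
  assumes "\<mu> \<in> paths L" "\<nu> \<in> paths L" "(\<alpha>, \<beta>) \<in> Lambda_min L \<mu> \<nu>"
  shows "(\<beta>, \<alpha>) \<in> Lambda_min L \<nu> \<mu>"
proof -
  have "vec_max (deg L \<mu>) (deg L \<nu>) = vec_max (deg L \<nu>) (deg L \<mu>)"
    by (simp add: vec_max_def max.commute)
  thus ?thesis
    using assms(3) Lambda_min_iff[OF assms(1,2), of \<alpha> \<beta>] Lambda_min_iff[OF assms(2,1), of \<beta> \<alpha>] by metis
qed

lemma Lambda_min_diagonal:
  assumes "\<mu> \<in> paths L"
  shows "Lambda_min L \<mu> \<mu> = {(src L \<mu>, src L \<mu>)}"
proof -
  have vm: "vec_max (deg L \<mu>) (deg L \<mu>) = deg L \<mu>" by (simp add: vec_max_def vec_eq_iff)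
  have "\<alpha> = src L \<mu> \<and> \<beta> = src L \<mu>" if "(\<alpha>, \<beta>) \<in> Lambda_min L \<mu> \<mu>" for \<alpha> \<beta>
  proof -
    from that have *: "\<alpha> \<in> paths L" "rng L \<alpha> = src L \<mu>" "\<beta> \<in> paths L" "rng L \<beta> = src L \<mu>"
      "comp L \<mu> \<alpha> = comp L \<mu> \<beta>" "deg L (comp L \<mu> \<alpha>) = deg L \<mu>"
      by (auto simp: Lambda_min_iff assms vm paths_to_def)
    hence "deg L \<alpha> = 0" using deg_comp[of \<mu> \<alpha>] assms by simp
    hence "\<alpha> = src L \<mu>" using * vertex_is_identity(1)[of \<alpha>] by simp
    moreover have "\<alpha> = \<beta>"
      by (rule comp_left_cancel[OF assms]) (use * in \<open>auto simp: paths_to_def\<close>)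
    ultimately show ?thesis by simp
  qed
  hence "Lambda_min L \<mu> \<mu> \<subseteq> {(src L \<mu>, src L \<mu>)}" by (intro subsetI) (metis prod.collapse singletonI)
  moreover have "(src L \<mu>, src L \<mu>) \<in> Lambda_min L \<mu> \<mu>"
    by (simp add: Lambda_min_iff assms vm paths_to_def src_closed rng_src comp_id_right)
  ultimately show ?thesis by blast
qed

lemma finite_Lambda_min:
  assumes "finitely_aligned L" "\<mu> \<in> paths L" "\<nu> \<in> paths L"
  shows "finite (Lambda_min L \<mu> \<nu>)"
proof (rule finite_imageD)
  show "finite ((\<lambda>p. comp L \<mu> (fst p)) ` Lambda_min L \<mu> \<nu>)"
  proof (rule finite_subset)
    show "(\<lambda>p. comp L \<mu> (fst p)) ` Lambda_min L \<mu> \<nu> \<subseteq> MCE L \<mu> \<nu>"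
      unfolding Lambda_min_def by auto
    show "finite (MCE L \<mu> \<nu>)" using assms by (simp add: finitely_aligned_def)
  qed
  show "inj_on (\<lambda>p. comp L \<mu> (fst p)) (Lambda_min L \<mu> \<nu>)"
  proof (rule inj_onI, clarsimp)
    fix \<alpha> \<beta> \<alpha>' \<beta>'
    assume *: "(\<alpha>, \<beta>) \<in> Lambda_min L \<mu> \<nu>" "(\<alpha>', \<beta>') \<in> Lambda_min L \<mu> \<nu>" "comp L \<mu> \<alpha> = comp L \<mu> \<alpha>'"
    hence "\<alpha> = \<alpha>'" using comp_left_cancel[of \<mu> \<alpha> \<alpha>'] assms by (simp add: Lambda_min_def)
    moreover from * have "comp L \<nu> \<beta> = comp L \<nu> \<beta>'" by (simp add: Lambda_min_def)
    hence "\<beta> = \<beta>'" using comp_left_cancel[of \<nu> \<beta> \<beta>'] assms * by (simp add: Lambda_min_def)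
    ultimately show "\<alpha> = \<alpha>' \<and> \<beta> = \<beta>'" by simp
  qed
qed

text \<open>
  A common extension \<open>\<kappa>\<close> of \<open>\<mu>\<close> and \<open>\<nu>\<close> has degree at least the join of their degrees; its initial
  segment of exactly that degree again begins with \<open>\<mu>\<close> and with \<open>\<nu>\<close>, by uniqueness of
  factorisations, so \<open>\<kappa>\<close> passes through a minimal common extension.
\<close>

lemma common_extension_via_minimal:
  assumes "\<mu> \<in> paths L" "\<nu> \<in> paths L" "\<alpha> \<in> paths_to L (src L \<mu>)" "\<beta> \<in> paths_to L (src L \<nu>)"
    and eq: "comp L \<mu> \<alpha> = comp L \<nu> \<beta>"
  obtains \<alpha>' \<beta>' \<rho> where "(\<alpha>', \<beta>') \<in> Lambda_min L \<mu> \<nu>" "\<rho> \<in> paths_to L (src L \<alpha>')"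
    "\<alpha> = comp L \<alpha>' \<rho>"
proof -
  have a: "\<alpha> \<in> paths L" "src L \<mu> = rng L \<alpha>" and b: "\<beta> \<in> paths L" "src L \<nu> = rng L \<beta>"
    using assms by (auto simp: paths_to_def)
  let ?\<kappa> = "comp L \<mu> \<alpha>"
  have k: "?\<kappa> \<in> paths L" using a assms comp_closed by blast
  have le: "deg L \<mu> \<le> deg L ?\<kappa>"
    using deg_comp[OF assms(1) a] by (simp add: less_eq_vec_def)
  have le': "deg L \<nu> \<le> deg L ?\<kappa>"
    unfolding eq using deg_comp[OF assms(2) b] by (simp add: less_eq_vec_def)
  obtain \<eta> \<rho> where e: "\<eta> \<in> paths L" "\<rho> \<in> paths L" "src L \<eta> = rng L \<rho>"
    "deg L \<eta> = vec_max (deg L \<mu>) (deg L \<nu>)" "?\<kappa> = comp L \<eta> \<rho>"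
    using initial_factor_exists[OF k vec_max_least[OF le le']] .
  have through: "\<exists>\<alpha>'. \<alpha>' \<in> paths L \<and> rng L \<alpha>' = src L \<mu> \<and> src L \<alpha>' = src L \<eta> \<and>
      \<eta> = comp L \<mu> \<alpha>' \<and> \<alpha> = comp L \<alpha>' \<rho>"
    if m: "\<mu> \<in> paths L" "\<alpha> \<in> paths L" "src L \<mu> = rng L \<alpha>" "comp L \<mu> \<alpha> = comp L \<eta> \<rho>"
      "deg L \<mu> \<le> deg L \<eta>" for \<mu> \<alpha>
  proof -
    obtain \<mu>' \<alpha>' where f: "\<mu>' \<in> paths L" "\<alpha>' \<in> paths L" "src L \<mu>' = rng L \<alpha>'"
      "deg L \<mu>' = deg L \<mu>" "\<eta> = comp L \<mu>' \<alpha>'"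
      using initial_factor_exists[OF e(1) m(5)] .
    have s: "src L \<alpha>' = src L \<eta>" using f src_comp by simp
    have c: "comp L \<alpha>' \<rho> \<in> paths L" "rng L (comp L \<alpha>' \<rho>) = rng L \<alpha>'"
      using f e s comp_closed rng_comp by auto
    have "comp L \<mu> \<alpha> = comp L \<mu>' (comp L \<alpha>' \<rho>)"
      using m(4) f e s comp_assoc[of \<mu>' \<alpha>' \<rho>] by simp
    hence "\<mu> = \<mu>' \<and> \<alpha> = comp L \<alpha>' \<rho>"
      using factorisation_unique[OF m(1-3) f(1) c(1)] f c by simp
    thus ?thesis using f s by auto
  qed
  obtain \<alpha>' where a': "\<alpha>' \<in> paths L" "rng L \<alpha>' = src L \<mu>" "src L \<alpha>' = src L \<eta>"
    "\<eta> = comp L \<mu> \<alpha>'" "\<alpha> = comp L \<alpha>' \<rho>"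
    using through[of \<mu> \<alpha>] assms a e vec_max_upper by metis
  obtain \<beta>' where b': "\<beta>' \<in> paths L" "rng L \<beta>' = src L \<nu>" "\<eta> = comp L \<nu> \<beta>'"
    using through[of \<nu> \<beta>] assms b e vec_max_upper by metis
  show thesis
    by (rule that[of \<alpha>' \<beta>' \<rho>]) (use assms a' b' e in \<open>auto simp: Lambda_min_iff paths_to_def\<close>)
qed

section \<open>Finite exhaustive sets\<close>

definition meets :: "'l \<Rightarrow> 'l \<Rightarrow> bool" where
  "meets \<mu> \<nu> \<longleftrightarrow> (\<exists>\<alpha>\<in>paths_to L (src L \<mu>). \<exists>\<beta>\<in>paths_to L (src L \<nu>). comp L \<mu> \<alpha> = comp L \<nu> \<beta>)"

text \<open>
  A common extension passes through a minimal one, so exhaustiveness is a statement about common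
  extensions of any degree; in this form it is easy to transport along compositions.
\<close>

lemma exhaustive_iff_meets:
  "exhaustive L v E \<longleftrightarrow> E \<subseteq> paths_to L v \<and> (\<forall>\<kappa>\<in>paths_to L v. \<exists>\<nu>\<in>E. meets \<kappa> \<nu>)"
proof -
  have "Ext L \<kappa> E \<noteq> {} \<longleftrightarrow> (\<exists>\<nu>\<in>E. meets \<kappa> \<nu>)"
    if "E \<subseteq> paths_to L v" "\<kappa> \<in> paths_to L v" for \<kappa>
  proof
    assume "Ext L \<kappa> E \<noteq> {}"
    thus "\<exists>\<nu>\<in>E. meets \<kappa> \<nu>"
      unfolding Ext_def Lambda_min_def meets_def by blast
  next
    assume "\<exists>\<nu>\<in>E. meets \<kappa> \<nu>"
    then obtain \<nu> \<alpha> \<beta> where *: "\<nu> \<in> E" "\<alpha> \<in> paths_to L (src L \<kappa>)" "\<beta> \<in> paths_to L (src L \<nu>)"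
      "comp L \<kappa> \<alpha> = comp L \<nu> \<beta>" unfolding meets_def by blast
    have "\<kappa> \<in> paths L" "\<nu> \<in> paths L" using that * by (auto simp: paths_to_def)
    from common_extension_via_minimal[OF this *(2-4)]
    obtain \<alpha>' \<beta>' where "(\<alpha>', \<beta>') \<in> Lambda_min L \<kappa> \<nu>" by metis
    thus "Ext L \<kappa> E \<noteq> {}" using *(1) unfolding Ext_def Lambda_min_def by blast
  qed
  thus ?thesis unfolding exhaustive_def by blast
qed

lemma vertex_path: "v \<in> vertices L \<Longrightarrow> v \<in> paths_to L v"
  by (auto simp: vertices_def paths_to_def vertex_is_identity)

lemma range_vertex_eq:
  assumes "v \<in> vertices L" "exhaustive L v E"
  shows "range_vertex L E = v"
  unfolding range_vertex_def
proof (rule the_equality)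
  show "v \<in> vertices L \<and> E \<subseteq> paths_to L v" using assms by (simp add: exhaustive_def)
  fix w assume "w \<in> vertices L \<and> E \<subseteq> paths_to L w"
  moreover have "\<exists>\<nu>. \<nu> \<in> E" using assms vertex_path exhaustive_iff_meets by blast
  ultimately show "w = v" using assms by (auto simp: exhaustive_def paths_to_def)
qed

lemma FE_intro:
  assumes "v \<in> vertices L" "finite E"
    and "\<And>\<kappa>. \<kappa> \<in> E \<Longrightarrow> \<kappa> \<in> paths L \<and> rng L \<kappa> = v \<and> deg L \<kappa> \<noteq> 0"
    and "\<And>\<kappa>. \<kappa> \<in> paths_to L v \<Longrightarrow> \<exists>\<nu>\<in>E. meets \<kappa> \<nu>"
  shows "E \<in> FE L" "range_vertex L E = v"
proof -
  have "exhaustive L v E" using assms by (auto simp: exhaustive_iff_meets paths_to_def)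
  thus "E \<in> FE L" "range_vertex L E = v"
    using assms range_vertex_eq by (auto simp: FE_def vertices_def paths_to_def)
qed

lemma FE_D:
  assumes "E \<in> FE L"
  shows "range_vertex L E \<in> vertices L" "finite E" "E \<noteq> {}"
    and "\<kappa> \<in> E \<Longrightarrow> \<kappa> \<in> paths L" "\<kappa> \<in> E \<Longrightarrow> rng L \<kappa> = range_vertex L E"
    and "\<kappa> \<in> E \<Longrightarrow> deg L \<kappa> \<noteq> 0"
    and "\<kappa> \<in> paths_to L (range_vertex L E) \<Longrightarrow> \<exists>\<nu>\<in>E. meets \<kappa> \<nu>"
proof -
  from assms obtain v where v: "v \<in> vertices L" "E \<subseteq> paths_to L v - {v}" "finite E" "exhaustive L v E"
    by (auto simp: FE_def)
  have r: "range_vertex L E = v" using range_vertex_eq v by blast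
  show "range_vertex L E \<in> vertices L" "finite E" using v r by auto
  show "E \<noteq> {}" using v vertex_path by (auto simp: exhaustive_iff_meets)
  show "\<kappa> \<in> E \<Longrightarrow> \<kappa> \<in> paths L" and e: "\<kappa> \<in> E \<Longrightarrow> rng L \<kappa> = range_vertex L E"
    using v r by (auto simp: paths_to_def)
  show "\<kappa> \<in> E \<Longrightarrow> deg L \<kappa> \<noteq> 0"
    using v(2) vertex_is_identity(1)[of \<kappa>] by (auto simp: paths_to_def)
  show "\<kappa> \<in> paths_to L (range_vertex L E) \<Longrightarrow> \<exists>\<nu>\<in>E. meets \<kappa> \<nu>"
    using v r by (simp add: exhaustive_iff_meets)
qed

text \<open>
  A common extension of \<open>\<mu>\<kappa>\<close> with some \<open>\<nu> \<in> G\<close> passes through a minimal common extension \<open>\<mu>\<alpha>\<close> of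
  \<open>\<mu>\<close> and \<open>\<nu>\<close>; cancelling \<open>\<mu>\<close> leaves a common extension of \<open>\<kappa>\<close> and \<open>\<alpha> \<in> Ext(\<mu>;G)\<close>.
\<close>

lemma Ext_in_FE:
  assumes "finitely_aligned L" "G \<in> FE L" "\<mu> \<in> paths_to L (range_vertex L G) - extensions L G"
  shows "Ext L \<mu> G \<in> FE L" "range_vertex L (Ext L \<mu> G) = src L \<mu>"
proof -
  note G = FE_D[OF assms(2)]
  have mu: "\<mu> \<in> paths L" "rng L \<mu> = range_vertex L G" "\<mu> \<notin> extensions L G"
    using assms by (auto simp: paths_to_def)
  have fin: "finite (Ext L \<mu> G)"
  proof (rule finite_subset)
    show "Ext L \<mu> G \<subseteq> fst ` (\<Union>\<nu>\<in>G. Lambda_min L \<mu> \<nu>)" unfolding Ext_def by force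
    show "finite (fst ` (\<Union>\<nu>\<in>G. Lambda_min L \<mu> \<nu>))"
      using assms G mu finite_Lambda_min by auto
  qed
  have elt: "\<alpha> \<in> paths L \<and> rng L \<alpha> = src L \<mu> \<and> deg L \<alpha> \<noteq> 0" if "\<alpha> \<in> Ext L \<mu> G" for \<alpha>
  proof -
    obtain \<nu> \<beta> where *: "\<nu> \<in> G" "\<alpha> \<in> paths_to L (src L \<mu>)" "\<beta> \<in> paths_to L (src L \<nu>)"
      "comp L \<mu> \<alpha> = comp L \<nu> \<beta>"
      using \<open>\<alpha> \<in> Ext L \<mu> G\<close> by (auto simp: Ext_def Lambda_min_def)
    hence a: "\<alpha> \<in> paths L" "rng L \<alpha> = src L \<mu>" by (auto simp: paths_to_def)
    have "deg L \<alpha> \<noteq> 0"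
    proof
      \<comment> \<open>Otherwise \<open>\<mu> = \<nu>\<beta>\<close> would extend a path of \<open>G\<close>.\<close>
      assume "deg L \<alpha> = 0"
      hence "\<alpha> = src L \<mu>" using a vertex_is_identity by metis
      hence "\<mu> = comp L \<nu> \<beta>" using * comp_id_right mu by simp
      thus False using mu(3) * unfolding extensions_def by blast
    qed
    thus ?thesis using a by simp
  qed
  have exh: "\<exists>\<alpha>\<in>Ext L \<mu> G. meets \<kappa> \<alpha>" if "\<kappa> \<in> paths_to L (src L \<mu>)" for \<kappa>
  proof -
    have k: "\<kappa> \<in> paths L" "src L \<mu> = rng L \<kappa>" using that by (auto simp: paths_to_def)
    have mk: "comp L \<mu> \<kappa> \<in> paths_to L (range_vertex L G)"
      using k mu comp_closed rng_comp by (auto simp: paths_to_def)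
    then obtain \<nu> where nu: "\<nu> \<in> G" "meets (comp L \<mu> \<kappa>) \<nu>" using G(7) by blast
    then obtain \<sigma> \<tau> where st: "\<sigma> \<in> paths L" "src L \<kappa> = rng L \<sigma>" "\<tau> \<in> paths_to L (src L \<nu>)"
      "comp L (comp L \<mu> \<kappa>) \<sigma> = comp L \<nu> \<tau>"
      using k mu src_comp by (auto simp: meets_def paths_to_def)
    have ks: "comp L \<kappa> \<sigma> \<in> paths_to L (src L \<mu>)"
      using k st comp_closed rng_comp by (auto simp: paths_to_def)
    have "comp L \<mu> (comp L \<kappa> \<sigma>) = comp L \<nu> \<tau>"
      using comp_assoc[of \<mu> \<kappa> \<sigma>] k st mu by simp
    then obtain \<alpha> \<beta> \<rho> where "(\<alpha>, \<beta>) \<in> Lambda_min L \<mu> \<nu>" "\<rho> \<in> paths_to L (src L \<alpha>)"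
      "comp L \<kappa> \<sigma> = comp L \<alpha> \<rho>"
      using common_extension_via_minimal[OF mu(1) G(4)[OF nu(1)] ks st(3)] by metis
    moreover from this have "\<alpha> \<in> Ext L \<mu> G"
    using nu(1) Lambda_min_iff[OF mu(1) G(4)[OF nu(1)]] unfolding Ext_def by blast
    moreover have "\<sigma> \<in> paths_to L (src L \<kappa>)" using st by (auto simp: paths_to_def)
    ultimately show ?thesis unfolding meets_def by blast
  qed
  show "Ext L \<mu> G \<in> FE L" "range_vertex L (Ext L \<mu> G) = src L \<mu>"
    using FE_intro[OF src_in_vertices[OF mu(1)] fin elt exh] by blast+
qed

lemma initial_segmentE:
  assumes "\<kappa> \<in> paths L" "n \<le> deg L \<kappa>"
  obtains \<nu> where "\<nu> \<in> paths L" "segment L \<kappa> 0 n \<in> paths L" "src L (segment L \<kappa> 0 n) = rng L \<nu>"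
    "deg L (segment L \<kappa> 0 n) = n" "\<kappa> = comp L (segment L \<kappa> 0 n) \<nu>"
  using initial_factor_exists[OF assms] segment_initial by metis

lemma meets_initial:
  assumes "meets \<kappa> (comp L \<mu> \<nu>)" "\<mu> \<in> paths L" "\<nu> \<in> paths L" "src L \<mu> = rng L \<nu>"
  shows "meets \<kappa> \<mu>"
proof -
  obtain \<alpha> \<beta> where *: "\<alpha> \<in> paths_to L (src L \<kappa>)" "\<beta> \<in> paths L" "src L \<nu> = rng L \<beta>"
    "comp L \<kappa> \<alpha> = comp L (comp L \<mu> \<nu>) \<beta>"
    using assms src_comp by (auto simp: meets_def paths_to_def)
  hence "comp L \<kappa> \<alpha> = comp L \<mu> (comp L \<nu> \<beta>)" using comp_assoc assms by simp
  moreover have "comp L \<nu> \<beta> \<in> paths_to L (src L \<mu>)"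
    using * assms comp_closed rng_comp by (auto simp: paths_to_def)
  ultimately show ?thesis using * unfolding meets_def by blast
qed

lemma initial_segments_in_FE:
  assumes "G \<in> FE L" "\<And>\<kappa>. \<kappa> \<in> G \<Longrightarrow> 0 < n \<kappa> \<and> n \<kappa> \<le> deg L \<kappa>"
  shows "(\<lambda>\<kappa>. segment L \<kappa> 0 (n \<kappa>)) ` G \<in> FE L"
    and "range_vertex L ((\<lambda>\<kappa>. segment L \<kappa> 0 (n \<kappa>)) ` G) = range_vertex L G"
proof -
  note G = FE_D[OF assms(1)]
  have fin: "finite ((\<lambda>\<kappa>. segment L \<kappa> 0 (n \<kappa>)) ` G)" using G by simp
  have elt: "\<mu> \<in> paths L \<and> rng L \<mu> = range_vertex L G \<and> deg L \<mu> \<noteq> 0"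
    if mu: "\<mu> \<in> (\<lambda>\<kappa>. segment L \<kappa> 0 (n \<kappa>)) ` G" for \<mu>
  proof -
    obtain \<kappa> where k: "\<kappa> \<in> G" "\<mu> = segment L \<kappa> 0 (n \<kappa>)" using mu by blast
    obtain \<nu> where "\<nu> \<in> paths L" "\<mu> \<in> paths L" "src L \<mu> = rng L \<nu>" "deg L \<mu> = n \<kappa>"
      "\<kappa> = comp L \<mu> \<nu>"
      using initial_segmentE[of \<kappa> "n \<kappa>"] k assms(2) G by metis
    moreover have "n \<kappa> \<noteq> 0" using assms(2)[OF k(1)] by auto
    ultimately show ?thesis using rng_comp G k by metis
  qed
  have exh: "\<exists>\<nu>\<in>(\<lambda>\<kappa>. segment L \<kappa> 0 (n \<kappa>)) ` G. meets \<kappa> \<nu>"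
    if k: "\<kappa> \<in> paths_to L (range_vertex L G)" for \<kappa>
  proof -
    obtain \<nu> where "\<nu> \<in> G" "meets \<kappa> \<nu>" using G(7)[OF k] by blast
    moreover from this have "meets \<kappa> (segment L \<nu> 0 (n \<nu>))"
      using initial_segmentE[of \<nu> "n \<nu>"] meets_initial assms(2) G(4) by metis
    ultimately show ?thesis by blast
  qed
  show "(\<lambda>\<kappa>. segment L \<kappa> 0 (n \<kappa>)) ` G \<in> FE L"
    "range_vertex L ((\<lambda>\<kappa>. segment L \<kappa> 0 (n \<kappa>)) ` G) = range_vertex L G"
    using FE_intro[OF G(1) fin elt exh] by blast+
qed

text \<open>
  Replacing \<open>\<lambda> \<in> G\<close> by \<open>\<lambda>H\<close> preserves exhaustiveness: if \<open>\<kappa>\<close> and \<open>\<lambda>\<close> have a common extension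
  \<open>\<lambda>\<beta>\<close>, then \<open>\<beta>\<close> can be extended so as to pass through \<open>H\<close>.
\<close>

lemma substitution_in_FE:
  assumes "G \<in> FE L" "G' \<subseteq> G" "\<And>\<kappa>. \<kappa> \<in> G' \<Longrightarrow> H \<kappa> \<in> FE L \<and> range_vertex L (H \<kappa>) = src L \<kappa>"
  shows "(G - G') \<union> (\<Union>\<kappa>\<in>G'. left_translate L \<kappa> (H \<kappa>)) \<in> FE L" (is "?K \<in> _")
    and "range_vertex L ((G - G') \<union> (\<Union>\<kappa>\<in>G'. left_translate L \<kappa> (H \<kappa>))) = range_vertex L G"
proof -
  note G = FE_D[OF assms(1)]
  have H: "\<mu> \<in> paths L" "rng L \<mu> = src L \<kappa>" "deg L \<mu> \<noteq> 0" if "\<kappa> \<in> G'" "\<mu> \<in> H \<kappa>" for \<kappa> \<mu>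
    using FE_D[of "H \<kappa>"] assms(3) that by auto
  have fin: "finite ?K"
  proof -
    have "finite (left_translate L \<kappa> (H \<kappa>))" if "\<kappa> \<in> G'" for \<kappa>
    proof (rule finite_subset)
      show "left_translate L \<kappa> (H \<kappa>) \<subseteq> comp L \<kappa> ` H \<kappa>" unfolding left_translate_def by blast
      show "finite (comp L \<kappa> ` H \<kappa>)" using FE_D(2) assms(3) that by blast
    qed
    thus ?thesis using G(2) assms(2) by (auto intro: finite_subset)
  qed
  have elt: "\<eta> \<in> paths L \<and> rng L \<eta> = range_vertex L G \<and> deg L \<eta> \<noteq> 0" if eta: "\<eta> \<in> ?K" for \<eta>
  proof (cases "\<eta> \<in> G")
    case True
    thus ?thesis using G by blast
  next
    case False
    then obtain \<kappa> \<mu> where "\<kappa> \<in> G'" "\<mu> \<in> H \<kappa>" "\<eta> = comp L \<kappa> \<mu>"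
      using eta unfolding left_translate_def by blast
    moreover from this have "\<kappa> \<in> paths L" "rng L \<kappa> = range_vertex L G" using G assms(2) by auto
    ultimately show ?thesis
      using H[of \<kappa> \<mu>] by (auto simp: comp_closed rng_comp deg_comp vec_eq_iff)
  qed
  have exh: "\<exists>\<nu>\<in>?K. meets \<kappa> \<nu>" if "\<kappa> \<in> paths_to L (range_vertex L G)" for \<kappa>
  proof -
    have k: "\<kappa> \<in> paths L" using that by (simp add: paths_to_def)
    have "\<exists>\<nu>\<in>G. meets \<kappa> \<nu>" using G(7) that by blast
    then obtain \<nu> where nu: "\<nu> \<in> G" "meets \<kappa> \<nu>" by blast
    show ?thesis
    proof (cases "\<nu> \<in> G'")
      case False
      thus ?thesis using nu by blast
    next
      case True
      have n: "\<nu> \<in> paths L" using nu G by blast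
      obtain \<alpha> \<beta> where ab: "\<alpha> \<in> paths L" "rng L \<alpha> = src L \<kappa>" "\<beta> \<in> paths L" "rng L \<beta> = src L \<nu>"
        "comp L \<kappa> \<alpha> = comp L \<nu> \<beta>"
        using nu by (auto simp: meets_def paths_to_def)
      then obtain \<mu> where mu: "\<mu> \<in> H \<nu>" "meets \<beta> \<mu>"
        using FE_D(7)[of "H \<nu>" \<beta>] assms(3)[OF True] by (auto simp: paths_to_def)
      then obtain \<sigma> \<tau> where st: "\<sigma> \<in> paths L" "rng L \<sigma> = src L \<beta>" "\<tau> \<in> paths L" "rng L \<tau> = src L \<mu>"
        "comp L \<beta> \<sigma> = comp L \<mu> \<tau>"
        by (auto simp: meets_def paths_to_def)
      note m = H[OF True mu(1)]
      have s: "src L \<alpha> = src L \<beta>" using src_comp[of \<kappa> \<alpha>] src_comp[of \<nu> \<beta>] ab k n by simp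
      have "comp L \<kappa> (comp L \<alpha> \<sigma>) = comp L (comp L \<kappa> \<alpha>) \<sigma>"
        by (rule comp_assoc[symmetric]) (use ab k st s in auto)
      also have "\<dots> = comp L \<nu> (comp L \<beta> \<sigma>)"
        unfolding ab(5) by (rule comp_assoc) (use ab n st in auto)
      also have "\<dots> = comp L (comp L \<nu> \<mu>) \<tau>"
        unfolding st(5) by (rule comp_assoc[symmetric]) (use n m st in auto)
      finally have "meets \<kappa> (comp L \<nu> \<mu>)"
        unfolding meets_def paths_to_def using comp_closed rng_comp src_comp ab st s m n
        by (intro bexI[of _ "comp L \<alpha> \<sigma>"] bexI[of _ \<tau>]) auto
      moreover have "comp L \<nu> \<mu> \<in> ?K"
        using True mu(1) m unfolding left_translate_def by blast
      ultimately show ?thesis by blast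
    qed
  qed
  show "?K \<in> FE L" "range_vertex L ?K = range_vertex L G"
    using FE_intro[OF G(1) fin elt exh] by blast+
qed

end

section \<open>Non-unital ring arithmetic in a C*-algebra\<close>

lemma list_prod_Cons: "xs \<noteq> [] \<Longrightarrow> list_prod A (x # xs) = x \<otimes>\<^bsub>A\<^esub> list_prod A xs"
  by (cases xs) auto

context cstar_algebra
begin

lemma mult_zero_right: "x \<in> carrier A \<Longrightarrow> x \<otimes> \<zero> = \<zero>"
  using distrib_left[of \<zero> \<zero> x] M.add.l_cancel_one[of "x \<otimes> \<zero>" "x \<otimes> \<zero>"]
  by (simp add: mult_closed)

lemma mult_zero_left: "x \<in> carrier A \<Longrightarrow> \<zero> \<otimes> x = \<zero>"
  using distrib_right[of \<zero> \<zero> x] M.add.l_cancel_one[of "\<zero> \<otimes> x" "\<zero> \<otimes> x"]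
  by (simp add: mult_closed)

lemma star_zero: "star A \<zero> = \<zero>"
  using star_add[of \<zero> \<zero>] M.add.l_cancel_one[of "star A \<zero>" "star A \<zero>"]
  by (simp add: star_closed)

lemma diff_zero [simp]: "x \<in> carrier A \<Longrightarrow> x \<ominus> \<zero> = x"
  using M.minus_equality[of \<zero> \<zero>] by (simp add: M.minus_eq)

lemma diff_self [simp]: "x \<in> carrier A \<Longrightarrow> x \<ominus> x = \<zero>"
  by (simp add: M.minus_eq M.r_neg)

lemma mult_diff_right:
  assumes "x \<in> carrier A" "y \<in> carrier A" "z \<in> carrier A"
  shows "x \<otimes> (y \<ominus> z) = x \<otimes> y \<ominus> x \<otimes> z"
proof -
  have "x \<otimes> \<ominus> z \<oplus> x \<otimes> z = \<zero>"
    using distrib_left[of "\<ominus> z" z x] assms mult_zero_right by (simp add: M.l_neg)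
  hence "x \<otimes> \<ominus> z = \<ominus> (x \<otimes> z)" using assms mult_closed by (simp add: M.minus_equality)
  thus ?thesis using assms distrib_left by (simp add: M.minus_eq)
qed

lemma mult_diff_left:
  assumes "x \<in> carrier A" "y \<in> carrier A" "z \<in> carrier A"
  shows "(y \<ominus> z) \<otimes> x = y \<otimes> x \<ominus> z \<otimes> x"
proof -
  have "\<ominus> z \<otimes> x \<oplus> z \<otimes> x = \<zero>"
    using distrib_right[of "\<ominus> z" z x] assms mult_zero_left by (simp add: M.l_neg)
  hence "\<ominus> z \<otimes> x = \<ominus> (z \<otimes> x)" using assms mult_closed by (simp add: M.minus_equality)
  thus ?thesis using assms distrib_right by (simp add: M.minus_eq)
qed

lemma additive_finsum:
  assumes "\<And>x. x \<in> carrier A \<Longrightarrow> h x \<in> carrier A"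
    and "\<And>x y. x \<in> carrier A \<Longrightarrow> y \<in> carrier A \<Longrightarrow> h (x \<oplus> y) = h x \<oplus> h y" and "h \<zero> = \<zero>"
    and "finite S" "\<And>i. i \<in> S \<Longrightarrow> f i \<in> carrier A"
  shows "h (\<Oplus>i\<in>S. f i) = (\<Oplus>i\<in>S. h (f i))"
  using assms(4,5)
proof (induction S rule: finite_induct)
  case empty
  thus ?case using assms(3) by simp
next
  case (insert a S)
  hence f: "f \<in> S \<rightarrow> carrier A" "f a \<in> carrier A" by auto
  hence hf: "(\<lambda>i. h (f i)) \<in> S \<rightarrow> carrier A" "h (f a) \<in> carrier A" using assms(1) by auto
  show ?case using insert f hf assms(2) by (simp add: M.finsum_insert)
qed

lemma finsum_mult_right:
  assumes "finite S" "\<And>i. i \<in> S \<Longrightarrow> f i \<in> carrier A" "x \<in> carrier A"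
  shows "(\<Oplus>i\<in>S. f i) \<otimes> x = (\<Oplus>i\<in>S. f i \<otimes> x)"
  by (rule additive_finsum) (use assms mult_closed distrib_right mult_zero_left in auto)

lemma finsum_mult_left:
  assumes "finite S" "\<And>i. i \<in> S \<Longrightarrow> f i \<in> carrier A" "x \<in> carrier A"
  shows "x \<otimes> (\<Oplus>i\<in>S. f i) = (\<Oplus>i\<in>S. x \<otimes> f i)"
  by (rule additive_finsum) (use assms mult_closed distrib_left mult_zero_right in auto)

lemma star_finsum:
  assumes "finite S" "\<And>i. i \<in> S \<Longrightarrow> f i \<in> carrier A"
  shows "star A (\<Oplus>i\<in>S. f i) = (\<Oplus>i\<in>S. star A (f i))"
  by (rule additive_finsum) (use assms star_closed star_add star_zero in auto)

lemma list_prod_closed: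
  "xs \<noteq> [] \<Longrightarrow> set xs \<subseteq> carrier A \<Longrightarrow> list_prod A xs \<in> carrier A"
  by (induction xs rule: list_nonempty_induct) (auto simp: mult_closed list_prod_Cons)

end

text \<open>
  This replaces a product, which has to be listed in some order, by a condition that only sees the
  set of factors. For one direction, the product of the \<open>v - p i\<close> acts as the identity on an
  element fixed by \<open>v\<close> and killed by all \<open>p i\<close>; for the other, the product is itself such an
  element, since each \<open>p i\<close> can be moved past the other factors to the factor \<open>v - p i\<close>.
\<close>

lemma (in cstar_algebra) list_prod_complement_zero_iff:
  assumes v: "v \<in> carrier A" "v \<otimes> v = v" and "is \<noteq> []"
    and p: "\<And>i. i \<in> set is \<Longrightarrow> p i \<in> carrier A \<and> p i \<otimes> p i = p i \<and> v \<otimes> p i = p i \<and> p i \<otimes> v = p i"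
    and comm: "\<And>i j. i \<in> set is \<Longrightarrow> j \<in> set is \<Longrightarrow> p i \<otimes> p j = p j \<otimes> p i"
  shows "list_prod A (map (\<lambda>i. v \<ominus> p i) is) = \<zero> \<longleftrightarrow>
    (\<forall>x\<in>carrier A. v \<otimes> x = x \<and> (\<forall>i\<in>set is. p i \<otimes> x = \<zero>) \<longrightarrow> x = \<zero>)"
proof -
  let ?P = "\<lambda>is. list_prod A (map (\<lambda>i. v \<ominus> p i) is)"
  have closed: "?P js \<in> carrier A" if "js \<noteq> []" "set js \<subseteq> set is" for js
    by (rule list_prod_closed) (use that v p in auto)
  have fixes_x: "?P js \<otimes> x = x"
    if "js \<noteq> []" "set js \<subseteq> set is" "x \<in> carrier A" "v \<otimes> x = x" "\<forall>i\<in>set js. p i \<otimes> x = \<zero>" for js x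
    using that
  proof (induction js rule: list_nonempty_induct)
    case (single i)
    thus ?case using v p by (simp add: mult_diff_left)
  next
    case (cons i js)
    have "?P (i # js) \<otimes> x = (v \<ominus> p i) \<otimes> (?P js \<otimes> x)"
      using cons closed[of js] v p by (simp add: list_prod_Cons mult_assoc)
    also have "\<dots> = (v \<ominus> p i) \<otimes> x" using cons by simp
    also have "\<dots> = x" using cons v p by (simp add: mult_diff_left)
    finally show ?case .
  qed
  have v_fixes: "v \<otimes> ?P js = ?P js" if "js \<noteq> []" "set js \<subseteq> set is" for js
    using that
  proof (cases js)
    case (Cons i ks)
    have "v \<otimes> (v \<ominus> p i) = v \<ominus> p i" using Cons that v p by (simp add: mult_diff_right)
    thus ?thesis
      using Cons that v p closed[of ks]
      by (cases "ks = []") (auto simp: list_prod_Cons mult_assoc[symmetric])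
  qed simp
  have kills: "p i \<otimes> ?P js = \<zero>" if "js \<noteq> []" "set js \<subseteq> set is" "i \<in> set js" for i js
    using that
  proof (induction js rule: list_nonempty_induct)
    case (single j)
    thus ?case using v p by (simp add: mult_diff_right)
  next
    case (cons j js)
    have ij: "i \<in> set is" "j \<in> set is" using cons by auto
    have split: "p i \<otimes> ?P (j # js) = (p i \<otimes> (v \<ominus> p j)) \<otimes> ?P js"
      using cons closed[of js] v p ij by (simp add: list_prod_Cons mult_assoc)
    show ?case
    proof (cases "i = j")
      case True
      hence "p i \<otimes> (v \<ominus> p j) = \<zero>" using ij v p by (simp add: mult_diff_right)
      thus ?thesis using split closed[of js] cons by (simp add: mult_zero_left)
    next
      case False
      have "p i \<otimes> (v \<ominus> p j) = (v \<ominus> p j) \<otimes> p i"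
        using ij v p comm by (auto simp: mult_diff_right mult_diff_left)
      hence "p i \<otimes> ?P (j # js) = (v \<ominus> p j) \<otimes> (p i \<otimes> ?P js)"
        using split cons closed[of js] v p ij by (auto simp: mult_assoc)
      also have "\<dots> = \<zero>" using cons False ij v p by (auto simp: mult_zero_right)
      finally show ?thesis .
    qed
  qed
  show ?thesis
  proof
    assume "?P is = \<zero>"
    thus "\<forall>x\<in>carrier A. v \<otimes> x = x \<and> (\<forall>i\<in>set is. p i \<otimes> x = \<zero>) \<longrightarrow> x = \<zero>"
      using fixes_x[of "is"] assms(3) mult_zero_left by fastforce
  next
    assume "\<forall>x\<in>carrier A. v \<otimes> x = x \<and> (\<forall>i\<in>set is. p i \<otimes> x = \<zero>) \<longrightarrow> x = \<zero>"
    thus "?P is = \<zero>" using closed[of "is"] v_fixes[of "is"] kills[of "is"] assms(3) by blast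
  qed
qed

section \<open>The Cuntz--Krieger relations satisfied by a fixed family\<close>

text \<open>A relative Cuntz--Krieger family for no exhaustive sets: just the first three relations.\<close>

locale toeplitz_CK_family = k_graph L + cstar_algebra A
  for L :: "('l, 'k::finite) kgraph" and A :: "'a cstar" (structure) and t :: "'l \<Rightarrow> 'a" +
  assumes aligned: "finitely_aligned L"
    and toeplitz: "relative_CK_family L {} A t"
begin

lemma t_closed [simp]: "\<kappa> \<in> paths L \<Longrightarrow> t \<kappa> \<in> carrier A"
  and t_partial_isometry: "\<kappa> \<in> paths L \<Longrightarrow> t \<kappa> \<otimes> star A (t \<kappa>) \<otimes> t \<kappa> = t \<kappa>"
  and t_vertex: "v \<in> vertices L \<Longrightarrow> star A (t v) = t v \<and> t v \<otimes> t v = t v"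
  and t_comp: "\<kappa> \<in> paths L \<Longrightarrow> \<mu> \<in> paths L \<Longrightarrow> src L \<kappa> = rng L \<mu> \<Longrightarrow> t (comp L \<kappa> \<mu>) = t \<kappa> \<otimes> t \<mu>"
  and t_star_t: "\<kappa> \<in> paths L \<Longrightarrow> \<mu> \<in> paths L \<Longrightarrow>
    star A (t \<kappa>) \<otimes> t \<mu> = (\<Oplus>p\<in>Lambda_min L \<kappa> \<mu>. t (fst p) \<otimes> star A (t (snd p)))"
  using toeplitz by (auto simp: relative_CK_family_def partial_isometry_def projection_def)

lemma star_t_closed [simp]: "\<kappa> \<in> paths L \<Longrightarrow> star A (t \<kappa>) \<in> carrier A"
  by (simp add: star_closed)

lemma t_rng: "\<kappa> \<in> paths L \<Longrightarrow> t (rng L \<kappa>) \<otimes> t \<kappa> = t \<kappa>"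
  using t_comp[of "rng L \<kappa>" \<kappa>] by (simp add: rng_closed src_rng comp_id_left)

lemma star_t_rng: "\<kappa> \<in> paths L \<Longrightarrow> star A (t \<kappa>) \<otimes> t (rng L \<kappa>) = star A (t \<kappa>)"
  using star_mult[of "t (rng L \<kappa>)" "t \<kappa>"] t_rng rng_in_vertices t_vertex rng_closed by simp

lemma t_src_star: "\<kappa> \<in> paths L \<Longrightarrow> t (src L \<kappa>) \<otimes> star A (t \<kappa>) = star A (t \<kappa>)"
  using star_mult[of "t \<kappa>" "t (src L \<kappa>)"] t_comp[of \<kappa> "src L \<kappa>"]
  by (simp add: src_closed rng_src comp_id_right src_in_vertices t_vertex)

lemma star_t_comp:
  "\<kappa> \<in> paths L \<Longrightarrow> \<mu> \<in> paths L \<Longrightarrow> src L \<kappa> = rng L \<mu> \<Longrightarrow>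
    star A (t (comp L \<kappa> \<mu>)) = star A (t \<mu>) \<otimes> star A (t \<kappa>)"
  by (simp add: t_comp star_mult)

lemma source_projection: "\<kappa> \<in> paths L \<Longrightarrow> star A (t \<kappa>) \<otimes> t \<kappa> = t (src L \<kappa>)"
proof -
  assume k: "\<kappa> \<in> paths L"
  note s = src_in_vertices[OF k] src_closed[OF k]
  have "star A (t \<kappa>) \<otimes> t \<kappa> = t (src L \<kappa>) \<otimes> star A (t (src L \<kappa>))"
    using k s by (simp add: t_star_t Lambda_min_diagonal mult_closed Pi_def)
  thus ?thesis using s t_vertex by simp
qed

abbreviation range_proj :: "'l \<Rightarrow> 'a" where
  "range_proj \<kappa> \<equiv> t \<kappa> \<otimes> star A (t \<kappa>)"

text \<open>
  The product of the range projections of \<open>\<kappa>\<close> and \<open>\<mu>\<close> is the sum of the range projections of their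
  minimal common extensions. This makes it self-adjoint, which for a product of two self-adjoint
  elements means that they commute.
\<close>

lemma range_proj_commute:
  assumes k: "\<kappa> \<in> paths L" and m: "\<mu> \<in> paths L"
  shows "range_proj \<kappa> \<otimes> range_proj \<mu> = range_proj \<mu> \<otimes> range_proj \<kappa>"
proof -
  let ?M = "Lambda_min L \<kappa> \<mu>"
  have fin: "finite ?M" using finite_Lambda_min aligned k m by blast
  have M: "fst p \<in> paths L" "src L \<kappa> = rng L (fst p)" "snd p \<in> paths L" "src L \<mu> = rng L (snd p)"
      "comp L \<kappa> (fst p) = comp L \<mu> (snd p)" "comp L \<kappa> (fst p) \<in> paths L" if "p \<in> ?M" for p
    using that k m Lambda_min_iff[of \<kappa> \<mu> "fst p" "snd p"] comp_closed[of \<kappa> "fst p"]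
    by (auto simp: paths_to_def)
  have c: "t (fst p) \<otimes> star A (t (snd p)) \<in> carrier A" if "p \<in> ?M" for p
    using M[OF that] by (simp add: mult_closed)
  have "range_proj \<kappa> \<otimes> range_proj \<mu> = t \<kappa> \<otimes> (star A (t \<kappa>) \<otimes> t \<mu>) \<otimes> star A (t \<mu>)"
    using k m by (simp add: mult_assoc mult_closed)
  also have "\<dots> = (\<Oplus>p\<in>?M. t \<kappa> \<otimes> (t (fst p) \<otimes> star A (t (snd p))) \<otimes> star A (t \<mu>))"
    using k m c fin by (simp add: t_star_t finsum_mult_left finsum_mult_right mult_closed)
  also have "\<dots> = (\<Oplus>p\<in>?M. range_proj (comp L \<kappa> (fst p)))"
  proof (rule M.finsum_cong')
    fix p assume p: "p \<in> ?M"
    note M = M[OF p]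
    have "range_proj (comp L \<kappa> (fst p)) = t (comp L \<kappa> (fst p)) \<otimes> star A (t (comp L \<mu> (snd p)))"
      using M(5) by simp
    thus "t \<kappa> \<otimes> (t (fst p) \<otimes> star A (t (snd p))) \<otimes> star A (t \<mu>) = range_proj (comp L \<kappa> (fst p))"
      using M(1-4) k m t_comp[of \<kappa> "fst p"] star_t_comp[of \<mu> "snd p"]
      by (simp add: mult_assoc mult_closed)
  qed (use M in \<open>auto simp: mult_closed\<close>)
  finally have eq: "range_proj \<kappa> \<otimes> range_proj \<mu> = (\<Oplus>p\<in>?M. range_proj (comp L \<kappa> (fst p)))" .
  have "star A (\<Oplus>p\<in>?M. range_proj (comp L \<kappa> (fst p))) = (\<Oplus>p\<in>?M. star A (range_proj (comp L \<kappa> (fst p))))"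
    by (rule star_finsum) (use fin M in \<open>auto simp: mult_closed\<close>)
  also have "\<dots> = (\<Oplus>p\<in>?M. range_proj (comp L \<kappa> (fst p)))"
    by (rule M.finsum_cong') (use M in \<open>auto simp: mult_closed star_mult star_star\<close>)
  finally have "star A (range_proj \<kappa> \<otimes> range_proj \<mu>) = range_proj \<kappa> \<otimes> range_proj \<mu>"
    using eq by simp
  thus ?thesis using k m by (simp add: star_mult star_star mult_closed)
qed

text \<open>
  The Cuntz--Krieger relation at \<open>E\<close> in cancellation form. It is stated with \<open>t\<^sub>\<kappa>\<^sup>*\<close> in place of the
  range projection \<open>t\<^sub>\<kappa>t\<^sub>\<kappa>\<^sup>*\<close>, which has the same right annihilator, because adjoints compose well
  along paths.
\<close>

definition covers :: "'l set \<Rightarrow> bool" where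
  "covers E \<longleftrightarrow> (\<forall>x\<in>carrier A. t (range_vertex L E) \<otimes> x = x \<and> (\<forall>\<kappa>\<in>E. star A (t \<kappa>) \<otimes> x = \<zero>) \<longrightarrow> x = \<zero>)"

lemma range_proj_kills_iff:
  assumes "\<kappa> \<in> paths L" "x \<in> carrier A"
  shows "range_proj \<kappa> \<otimes> x = \<zero> \<longleftrightarrow> star A (t \<kappa>) \<otimes> x = \<zero>"
proof
  assume "range_proj \<kappa> \<otimes> x = \<zero>"
  hence "star A (t \<kappa>) \<otimes> (t \<kappa> \<otimes> (star A (t \<kappa>) \<otimes> x)) = \<zero>"
    using assms by (simp add: mult_assoc mult_closed mult_zero_right)
  moreover have "star A (t \<kappa>) \<otimes> (t \<kappa> \<otimes> (star A (t \<kappa>) \<otimes> x)) = t (src L \<kappa>) \<otimes> star A (t \<kappa>) \<otimes> x"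
    using assms source_projection[of \<kappa>] by (simp add: mult_assoc[symmetric] mult_closed)
  ultimately show "star A (t \<kappa>) \<otimes> x = \<zero>" using assms t_src_star by simp
qed (use assms in \<open>simp add: mult_assoc mult_zero_right\<close>)

lemma CK_relation_iff_covers:
  assumes "E \<in> FE L" "set es = E"
  shows "list_prod A (map (\<lambda>\<kappa>. t (range_vertex L E) \<ominus> (t \<kappa> \<otimes> star A (t \<kappa>))) es) = \<zero> \<longleftrightarrow> covers E"
proof -
  note E = FE_D[OF assms(1)]
  let ?v = "range_vertex L E"
  have v: "t ?v \<in> carrier A" "t ?v \<otimes> t ?v = t ?v"
    using E(1) t_vertex by (auto simp: vertices_def)
  have "list_prod A (map (\<lambda>\<kappa>. t ?v \<ominus> range_proj \<kappa>) es) = \<zero> \<longleftrightarrow>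
    (\<forall>x\<in>carrier A. t ?v \<otimes> x = x \<and> (\<forall>\<kappa>\<in>set es. range_proj \<kappa> \<otimes> x = \<zero>) \<longrightarrow> x = \<zero>)"
  proof (rule list_prod_complement_zero_iff[OF v])
    show "es \<noteq> []" using E(3) assms(2) by auto
    fix \<kappa> assume "\<kappa> \<in> set es"
    hence k: "\<kappa> \<in> paths L" and r: "?v = rng L \<kappa>" using E assms(2) by auto
    have "range_proj \<kappa> \<otimes> range_proj \<kappa> = (range_proj \<kappa> \<otimes> t \<kappa>) \<otimes> star A (t \<kappa>)"
      using k by (simp add: mult_assoc mult_closed)
    moreover have "t ?v \<otimes> range_proj \<kappa> = (t ?v \<otimes> t \<kappa>) \<otimes> star A (t \<kappa>)"
      using k v by (simp add: mult_assoc mult_closed)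
    moreover have "range_proj \<kappa> \<otimes> t ?v = t \<kappa> \<otimes> (star A (t \<kappa>) \<otimes> t ?v)"
      using k v by (simp add: mult_assoc mult_closed)
    ultimately show "range_proj \<kappa> \<in> carrier A \<and> range_proj \<kappa> \<otimes> range_proj \<kappa> = range_proj \<kappa> \<and>
        t ?v \<otimes> range_proj \<kappa> = range_proj \<kappa> \<and> range_proj \<kappa> \<otimes> t ?v = range_proj \<kappa>"
      using k r t_partial_isometry t_rng star_t_rng by (simp add: mult_closed)
  next
    fix \<kappa> \<mu> assume "\<kappa> \<in> set es" "\<mu> \<in> set es"
    thus "range_proj \<kappa> \<otimes> range_proj \<mu> = range_proj \<mu> \<otimes> range_proj \<kappa>"
      using E(4) assms(2) range_proj_commute by blast
  qed
  also have "\<dots> \<longleftrightarrow> covers E"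
    unfolding covers_def assms(2) using E(4) range_proj_kills_iff by blast
  finally show ?thesis .
qed

lemma relative_CK_family_iff_covers:
  assumes "\<E> \<subseteq> FE L"
  shows "relative_CK_family L \<E> A t \<longleftrightarrow> (\<forall>E\<in>\<E>. covers E)"
proof -
  have "(\<forall>es. distinct es \<and> set es = E \<longrightarrow>
      list_prod A (map (\<lambda>\<kappa>. t (range_vertex L E) \<ominus> (t \<kappa> \<otimes> star A (t \<kappa>))) es) = \<zero>) \<longleftrightarrow> covers E"
    if "E \<in> \<E>" for E
  proof -
    have E: "E \<in> FE L" using that assms by blast
    obtain es where "distinct es" "set es = E" using finite_distinct_list FE_D(2)[OF E] by blast
    thus ?thesis using CK_relation_iff_covers[OF E] by blast
  qed
  thus ?thesis using toeplitz by (simp add: relative_CK_family_def)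
qed

lemma covers_mono:
  assumes "covers G" "G \<subseteq> E" "G \<in> FE L" "E \<in> FE L"
  shows "covers E"
proof -
  have "range_vertex L G = range_vertex L E"
    using assms FE_D(3,5)[of G] FE_D(5)[of E] by fastforce
  thus ?thesis using assms unfolding covers_def by auto
qed

text \<open>
  If \<open>x\<close> is killed by \<open>t\<^sub>\<alpha>\<^sup>*\<close> for all \<open>\<alpha> \<in> Ext(\<mu>;G)\<close>, then \<open>t\<^sub>\<mu>x\<close> is killed by \<open>t\<^sub>\<nu>\<^sup>*\<close> for all \<open>\<nu> \<in> G\<close>,
  because the third relation expands \<open>t\<^sub>\<nu>\<^sup>*t\<^sub>\<mu>\<close> into terms ending in such \<open>t\<^sub>\<alpha>\<^sup>*\<close>.
\<close>

lemma covers_Ext: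
  assumes "covers G" "G \<in> FE L" "\<mu> \<in> paths_to L (range_vertex L G) - extensions L G"
  shows "covers (Ext L \<mu> G)"
  unfolding covers_def
proof (intro ballI impI, elim conjE)
  note G = FE_D[OF assms(2)]
  have m: "\<mu> \<in> paths L" "rng L \<mu> = range_vertex L G" using assms by (auto simp: paths_to_def)
  fix x assume x: "x \<in> carrier A" "t (range_vertex L (Ext L \<mu> G)) \<otimes> x = x"
    and kill: "\<forall>\<alpha>\<in>Ext L \<mu> G. star A (t \<alpha>) \<otimes> x = \<zero>"
  have fix_x: "t (src L \<mu>) \<otimes> x = x" using x Ext_in_FE[OF aligned assms(2,3)] by simp
  have "star A (t \<nu>) \<otimes> (t \<mu> \<otimes> x) = \<zero>" if "\<nu> \<in> G" for \<nu>
  proof -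
    have n: "\<nu> \<in> paths L" using G that by blast
    let ?M = "Lambda_min L \<nu> \<mu>"
    have M: "fst p \<in> paths L" "snd p \<in> paths L" "snd p \<in> Ext L \<mu> G" if "p \<in> ?M" for p
      using that Lambda_min_iff[of \<nu> \<mu> "fst p" "snd p"] Lambda_min_swap[of \<nu> \<mu> "fst p" "snd p"] n m \<open>\<nu> \<in> G\<close>
      by (auto simp: paths_to_def Ext_def)
    have "star A (t \<nu>) \<otimes> (t \<mu> \<otimes> x) = (\<Oplus>p\<in>?M. t (fst p) \<otimes> star A (t (snd p))) \<otimes> x"
      using n m x by (simp add: mult_assoc[symmetric] t_star_t)
    also have "\<dots> = (\<Oplus>p\<in>?M. t (fst p) \<otimes> star A (t (snd p)) \<otimes> x)"
      by (rule finsum_mult_right) (use finite_Lambda_min aligned n m x M in \<open>auto simp: mult_closed\<close>)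
    also have "\<dots> = (\<Oplus>p\<in>?M. \<zero>)"
      by (rule M.finsum_cong') (use M kill x in \<open>auto simp: mult_assoc mult_zero_right\<close>)
    finally show ?thesis by simp
  qed
  moreover have "t (range_vertex L G) \<otimes> (t \<mu> \<otimes> x) = t \<mu> \<otimes> x"
    using m x t_rng[of \<mu>] rng_closed[of \<mu>] by (simp add: mult_assoc[symmetric])
  ultimately have "t \<mu> \<otimes> x = \<zero>"
    using assms(1) m x mult_closed unfolding covers_def by simp
  hence "star A (t \<mu>) \<otimes> t \<mu> \<otimes> x = \<zero>" using m x by (simp add: mult_assoc mult_zero_right)
  thus "x = \<zero>" using source_projection[OF m(1)] fix_x by simp
qed

lemma covers_initial_segments:
  assumes "covers G" "G \<in> FE L" "\<And>\<kappa>. \<kappa> \<in> G \<Longrightarrow> 0 < n \<kappa> \<and> n \<kappa> \<le> deg L \<kappa>"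
  shows "covers ((\<lambda>\<kappa>. segment L \<kappa> 0 (n \<kappa>)) ` G)"
proof -
  note G = FE_D[OF assms(2)]
  have "star A (t \<kappa>) \<otimes> x = \<zero>"
    if k: "\<kappa> \<in> G" and x: "x \<in> carrier A" "star A (t (segment L \<kappa> 0 (n \<kappa>))) \<otimes> x = \<zero>" for \<kappa> x
  proof -
    obtain \<nu> where *: "\<nu> \<in> paths L" "segment L \<kappa> 0 (n \<kappa>) \<in> paths L"
      "src L (segment L \<kappa> 0 (n \<kappa>)) = rng L \<nu>" "\<kappa> = comp L (segment L \<kappa> 0 (n \<kappa>)) \<nu>"
      using initial_segmentE[OF G(4)[OF k]] assms(3)[OF k] by blast
    have "star A (t \<kappa>) = star A (t \<nu>) \<otimes> star A (t (segment L \<kappa> 0 (n \<kappa>)))"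
      using star_t_comp[OF *(2,1,3)] *(4) by simp
    thus ?thesis using * x by (simp add: mult_assoc mult_zero_right)
  qed
  moreover have "range_vertex L ((\<lambda>\<kappa>. segment L \<kappa> 0 (n \<kappa>)) ` G) = range_vertex L G"
    using initial_segments_in_FE(2) assms(2,3) .
  ultimately show ?thesis using assms(1) unfolding covers_def by auto
qed

text \<open>
  The property for \<open>H \<kappa>\<close>, applied to \<open>t\<^sub>\<kappa>\<^sup>*x\<close>, shows that \<open>t\<^sub>\<kappa>\<^sup>*x = 0\<close> also for the replaced paths \<open>\<kappa>\<close>,
  so that the property for \<open>G\<close> applies to \<open>x\<close>.
\<close>

lemma covers_substitution:
  assumes "covers G" "G \<in> FE L" "G' \<subseteq> G"
    and H: "\<And>\<kappa>. \<kappa> \<in> G' \<Longrightarrow> covers (H \<kappa>) \<and> H \<kappa> \<in> FE L \<and> range_vertex L (H \<kappa>) = src L \<kappa>"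
  shows "covers ((G - G') \<union> (\<Union>\<kappa>\<in>G'. left_translate L \<kappa> (H \<kappa>)))" (is "covers ?K")
  unfolding covers_def
proof (intro ballI impI, elim conjE)
  note G = FE_D[OF assms(2)]
  fix x assume x: "x \<in> carrier A" "t (range_vertex L ?K) \<otimes> x = x"
    and kill: "\<forall>\<kappa>\<in>?K. star A (t \<kappa>) \<otimes> x = \<zero>"
  have "star A (t \<kappa>) \<otimes> x = \<zero>" if "\<kappa> \<in> G" for \<kappa>
  proof (cases "\<kappa> \<in> G'")
    case False
    thus ?thesis using kill that by blast
  next
    case True
    note k = G(4)[OF that]
    have "star A (t \<mu>) \<otimes> (star A (t \<kappa>) \<otimes> x) = \<zero>" if "\<mu> \<in> H \<kappa>" for \<mu>
    proof -
      have m: "\<mu> \<in> paths L" "rng L \<mu> = src L \<kappa>" using FE_D(4,5)[of "H \<kappa>" \<mu>] H[OF True] that by auto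
      have "comp L \<kappa> \<mu> \<in> ?K" using True that m unfolding left_translate_def by blast
      hence "star A (t (comp L \<kappa> \<mu>)) \<otimes> x = \<zero>" using kill by blast
      thus ?thesis using star_t_comp[OF k m(1)] k m x by (simp add: mult_assoc)
    qed
    moreover have "t (src L \<kappa>) \<otimes> (star A (t \<kappa>) \<otimes> x) = star A (t \<kappa>) \<otimes> x"
      using k x t_src_star[of \<kappa>] src_closed[of \<kappa>] by (simp add: mult_assoc[symmetric])
    ultimately show ?thesis
      using H[OF True] k x mult_closed unfolding covers_def by simp
  qed
  moreover have "range_vertex L ?K = range_vertex L G"
    using substitution_in_FE(2) assms by blast
  ultimately show "x = \<zero>" using assms(1) x unfolding covers_def by simp
qed

lemma satiated_covers: "satiated L {E \<in> FE L. covers E}"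
  unfolding satiated_def
proof (intro conjI)
  let ?S = "{E \<in> FE L. covers E}"
  show "?S \<subseteq> FE L" by blast
  show "\<forall>G\<in>?S. \<forall>E\<in>FE L. G \<subseteq> E \<longrightarrow> E \<in> ?S" using covers_mono by blast
  show "\<forall>G\<in>?S. \<forall>\<mu>\<in>paths_to L (range_vertex L G) - extensions L G. Ext L \<mu> G \<in> ?S"
    using covers_Ext Ext_in_FE(1) aligned by blast
  show "\<forall>G\<in>?S. \<forall>n. (\<forall>\<kappa>\<in>G. 0 < n \<kappa> \<and> n \<kappa> \<le> deg L \<kappa>) \<longrightarrow> (\<lambda>\<kappa>. segment L \<kappa> 0 (n \<kappa>)) ` G \<in> ?S"
    using covers_initial_segments initial_segments_in_FE(1) by simp
  show "\<forall>G\<in>?S. \<forall>G'\<subseteq>G. \<forall>H. (\<forall>\<kappa>\<in>G'. H \<kappa> \<in> ?S \<and> range_vertex L (H \<kappa>) = src L \<kappa>) \<longrightarrow>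
      (G - G') \<union> (\<Union>\<kappa>\<in>G'. left_translate L \<kappa> (H \<kappa>)) \<in> ?S"
  proof (intro ballI allI impI)
    fix G G' H
    assume G: "G \<in> ?S" "G' \<subseteq> G"
      and "\<forall>\<kappa>\<in>G'. H \<kappa> \<in> ?S \<and> range_vertex L (H \<kappa>) = src L \<kappa>"
    hence H: "covers (H \<kappa>) \<and> H \<kappa> \<in> FE L \<and> range_vertex L (H \<kappa>) = src L \<kappa>" if "\<kappa> \<in> G'" for \<kappa>
      using that by blast
    show "(G - G') \<union> (\<Union>\<kappa>\<in>G'. left_translate L \<kappa> (H \<kappa>)) \<in> ?S"
    proof (rule CollectI, rule conjI)
      show "(G - G') \<union> (\<Union>\<kappa>\<in>G'. left_translate L \<kappa> (H \<kappa>)) \<in> FE L"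
        by (rule substitution_in_FE(1)[OF _ G(2) conjunct2[OF H]]) (use G(1) in simp)
      show "covers ((G - G') \<union> (\<Union>\<kappa>\<in>G'. left_translate L \<kappa> (H \<kappa>)))"
        by (rule covers_substitution[OF _ _ G(2) H]) (use G(1) in simp_all)
    qed
  qed
qed

end

lemma relative_CK_family_antimono:
  "relative_CK_family L \<E> A t \<Longrightarrow> \<D> \<subseteq> \<E> \<Longrightarrow> relative_CK_family L \<D> A t"
  unfolding relative_CK_family_def
  by (elim conjE, intro conjI; (assumption | (rule ballI, erule bspec, erule (1) subsetD)))

lemma relative_CK_family_satiation:
  assumes "k_graph L" "finitely_aligned L" "\<E> \<subseteq> FE L" "cstar_algebra A" "relative_CK_family L \<E> A t"
  shows "relative_CK_family L (satiation L \<E>) A t"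
proof -
  interpret k_graph L by fact
  interpret cstar_algebra A by fact
  interpret toeplitz_CK_family L A t
    by unfold_locales (rule assms(2), rule relative_CK_family_antimono[OF assms(5)], rule empty_subsetI)
  have "\<E> \<subseteq> {E \<in> FE L. covers E}" using assms relative_CK_family_iff_covers by blast
  hence "satiation L \<E> \<subseteq> {E \<in> FE L. covers E}"
    unfolding satiation_def using satiated_covers by blast
  thus ?thesis using relative_CK_family_iff_covers[of "satiation L \<E>"] by blast
qed

section \<open>Universality\<close>

lemma star_hom_id: "star_hom A A (\<lambda>x. x)"
  by (simp add: star_hom_def)

lemma star_hom_comp:
  assumes "star_hom A B \<phi>" "star_hom B C \<psi>"
  shows "star_hom A C (\<lambda>x. \<psi> (\<phi> x))"
proof -
  have "\<phi> x \<in> carrier B" if "x \<in> carrier A" for x using assms(1) that by (auto simp: star_hom_def)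
  thus ?thesis using assms unfolding star_hom_def by (auto simp: Pi_iff)
qed

text \<open>
  Each universal property yields a homomorphism to the other algebra matching the generators. The
  composites fix the generators, and so does the identity, hence they are equal by uniqueness.
\<close>

lemma universal_algebras_same_families_iso:
  fixes A B :: "'u cstar"
  assumes A: "is_relative_CK_algebra L \<E> A s" and B: "is_relative_CK_algebra L \<F> B s'"
    and "relative_CK_family L \<F> A s" "relative_CK_family L \<E> B s'"
  shows "\<exists>\<phi>. star_iso A B \<phi> \<and> (\<forall>\<kappa>\<in>paths L. \<phi> (s \<kappa>) = s' \<kappa>)"
proof -
  have identity: "\<forall>x\<in>carrier C. \<psi> x = x"
    if "is_relative_CK_algebra L \<G> C u" "star_hom C C \<psi>" "\<forall>\<kappa>\<in>paths L. \<psi> (u \<kappa>) = u \<kappa>"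
    for \<G> and C :: "'u cstar" and u \<psi>
  proof -
    have "cstar_algebra C" "relative_CK_family L \<G> C u"
      using that(1) by (auto simp: is_relative_CK_algebra_def)
    with that(1) obtain \<phi> where "\<And>\<psi>. star_hom C C \<psi> \<Longrightarrow> \<forall>\<kappa>\<in>paths L. \<psi> (u \<kappa>) = u \<kappa> \<Longrightarrow>
        \<forall>x\<in>carrier C. \<psi> x = \<phi> x"
      unfolding is_relative_CK_algebra_def by blast
    from this[OF that(2,3)] this[OF star_hom_id] show ?thesis by simp
  qed
  obtain \<phi> where phi: "star_hom A B \<phi>" "\<forall>\<kappa>\<in>paths L. \<phi> (s \<kappa>) = s' \<kappa>"
    using assms unfolding is_relative_CK_algebra_def by blast
  obtain \<psi> where psi: "star_hom B A \<psi>" "\<forall>\<kappa>\<in>paths L. \<psi> (s' \<kappa>) = s \<kappa>"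
    using assms unfolding is_relative_CK_algebra_def by blast
  have "\<forall>x\<in>carrier A. \<psi> (\<phi> x) = x" "\<forall>y\<in>carrier B. \<phi> (\<psi> y) = y"
    using identity[OF A star_hom_comp[OF phi(1) psi(1)]] identity[OF B star_hom_comp[OF psi(1) phi(1)]]
      phi(2) psi(2) by auto
  moreover have "\<phi> \<in> carrier A \<rightarrow> carrier B" "\<psi> \<in> carrier B \<rightarrow> carrier A"
    using phi psi by (auto simp: star_hom_def)
  ultimately have "bij_betw \<phi> (carrier A) (carrier B)"
    by (intro bij_betw_byWitness[where f' = \<psi>]) auto
  thus ?thesis using phi unfolding star_iso_def by blast
qed

theorem corollary5p6:
  fixes L :: "('l, 'k::finite) kgraph" and \<E> :: "'l set set"
    and A B :: "'u cstar" and s s' :: "'l \<Rightarrow> 'u"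
  assumes "k_graph L" and "finitely_aligned L" and "\<E> \<subseteq> FE L"
    and "is_relative_CK_algebra L \<E> A s"
    and "is_relative_CK_algebra L (satiation L \<E>) B s'"
  shows "\<exists>\<phi>. star_iso A B \<phi> \<and> (\<forall>\<kappa>\<in>paths L. \<phi> (s \<kappa>) = s' \<kappa>)"
proof (rule universal_algebras_same_families_iso[OF assms(4,5)])
  show "relative_CK_family L (satiation L \<E>) A s"
    using relative_CK_family_satiation assms unfolding is_relative_CK_algebra_def by blast
  have "\<E> \<subseteq> satiation L \<E>" unfolding satiation_def by blast
  thus "relative_CK_family L \<E> B s'"
    using relative_CK_family_antimono assms(5) unfolding is_relative_CK_algebra_def by blast
qed

end
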